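(* Let $X$ be the discrete-time Markov chain on $\mathscr{X}$ associated with $\rho$, $\nu$ and the policy $\phi$ defined in the context. Assume that $(\mathcal{G}_\rho,\nu)$ satisfies NCOND, and let $\pi$ be the unique invariant distribution of $X$ (which exists under NCOND). Then $$\lim_{t\to\infty}\frac1t\sum_{s=1}^t\|X_s\|=\int\pi(\mathrm{d}x)\,\|x\|<\infty\qquad\text{almost surely,}$$ and, as a consequence, $$\lim_{t\to\infty}\frac{\|X_t\|}{t}=0\qquad\text{almost surely.}$$
   Context: $\mathbb{N}_0=\{0,1,2,\dots\}$, $\mathbb{N}=\{1,2,\dots\}$. $\mathcal{C}$ is a finite set, $\nu$ a probability on $\mathcal{C}$ with $\nu(i)>0$ for all $i$, and $\rho\in[0,1]^{\mathcal{C}\times\mathcal{C}}$ a symmetric matrix. $\|x\|=\max_{i\in\mathcal{C}}|x(i)|$. Root graph and NCOND. $\mathcal{E}_\rho(i,j)=\mathbf{1}\{\rho(i,j)>0\}$, and $\mathcal{G}_\rho=(\mathcal{C},\mathcal{E}_\rho)$ is the undirected graph (self-loops allowed) with this adjacency matrix. $\mathcal{I}\subset\mathcal{C}$ is $\mathcal{G}_\rho$-independent if $\mathcal{E}_\rho(i,j)=0$ for all $i,j\in\mathcal{I}$ (including $i=j$); $\mathbb{I}_\rho$ is the collection of non-empty $\mathcal{G}_\rho$-independent sets. $\mathcal{N}_\rho(\mathcal{A})=\{j:\mathcal{E}_\rho(i,j)=1\text{ for some }i\in\mathcal{A}\}$, $\nu(\mathcal{A})=\sum_{i\in\mathcal{A}}\nu(i)$.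 NCOND means $\nu(\mathcal{I})<\nu(\mathcal{N}_\rho(\mathcal{I}))$ for all $\mathcal{I}\in\mathbb{I}_\rho$. Weight function $w:\mathbb{N}_0\times[0,1]\to[0,\infty)$, assumed to satisfy: (w1) $w(n,r)>0$ if and only if $n>0$ and $r>0$. (w2) $w$ is non-decreasing in each coordinate. (w3) For every $r\in(0,1]$ there is $m(r)\in\mathbb{N}$ such that $w(n-1,1)<w(n,r)$ and $w(n,1)<w(n+1,r)$ for every $n\ge m(r)$. Policy. Fix a bijection $\alpha:\mathcal{C}\to\{1,\dots,|\mathcal{C}|\}$. Then $\phi(x,i)=\arg\max_{j\in\mathcal{C}}(w(x(j),\rho(i,j)),\alpha(j))$ with the lexicographical order on pairs. Markov chain. With $1_i\in\mathbb{N}_0^{\mathcal{C}}$ the canonical vector and $0^0=1$, the only non-zero transition probabilities are $P(x,x+1_i)=\nu(i)(1-\rho(i,\phi(x,i)))^{x(\phi(x,i))}$, and, when $x-1_j\in\mathbb{N}_0^{\mathcal{C}}$, $P(x,x-1_j)=\sum_{i:\phi(x,i)=j}\nu(i)[1-(1-\rho(i,j))^{x(j)}]$. The chain $X=(X_t)_{t\in\mathbb{N}_0}$ starts from $X_0=0$ and its state space is $\mathscr{X}=\{x\in\mathbb{N}_0^{\mathcal{C}}:\mathbb{P}(X_t=x)>0\text{ for some }t\in\mathbb{N}_0\}$. *)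

theory Defs
  imports "HOL-Probability.Probability"
begin

text \<open>
  The finite set of classes is a type \<open>'c :: finite\<close>, and states are functions \<open>'c \<Rightarrow> nat\<close>.
\<close>

definition sup_norm :: "('c::finite \<Rightarrow> nat) \<Rightarrow> real" where
  "sup_norm x = (MAX i\<in>UNIV. \<bar>real (x i)\<bar>)"

definition root_edge :: "('c \<Rightarrow> 'c \<Rightarrow> real) \<Rightarrow> 'c \<Rightarrow> 'c \<Rightarrow> bool" where
  "root_edge \<rho> i j \<longleftrightarrow> \<rho> i j > 0"

text \<open>Self-loops are allowed, and the case \<open>i = j\<close> is deliberately included here.\<close>

definition root_independent :: "('c \<Rightarrow> 'c \<Rightarrow> real) \<Rightarrow> 'c set \<Rightarrow> bool" where
  "root_independent \<rho> I \<longleftrightarrow> (\<forall>i\<in>I. \<forall>j\<in>I. \<not> root_edge \<rho> i j)"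

definition root_neighbours :: "('c \<Rightarrow> 'c \<Rightarrow> real) \<Rightarrow> 'c set \<Rightarrow> 'c set" where
  "root_neighbours \<rho> A = {j. \<exists>i\<in>A. root_edge \<rho> i j}"

definition NCOND :: "('c \<Rightarrow> 'c \<Rightarrow> real) \<Rightarrow> 'c pmf \<Rightarrow> bool" where
  "NCOND \<rho> \<nu> \<longleftrightarrow>
     (\<forall>I. I \<noteq> {} \<and> root_independent \<rho> I \<longrightarrow>
        measure_pmf.prob \<nu> I < measure_pmf.prob \<nu> (root_neighbours \<rho> I))"

text \<open>
  Only the values \<open>w n r\<close> with \<open>0 \<le> r \<le> 1\<close> are constrained. In the last clause the
  truncated subtraction is harmless, because \<open>n \<ge> m \<ge> 1\<close>.
\<close>

definition weight_function :: "(nat \<Rightarrow> real \<Rightarrow> real) \<Rightarrow> bool" where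
  "weight_function w \<longleftrightarrow>
     (\<forall>n. \<forall>r\<in>{0..1}. 0 \<le> w n r) \<and>
     (\<forall>n. \<forall>r\<in>{0..1}. 0 < w n r \<longleftrightarrow> 0 < n \<and> 0 < r) \<and>
     (\<forall>n n'. \<forall>r\<in>{0..1}. n \<le> n' \<longrightarrow> w n r \<le> w n' r) \<and>
     (\<forall>n. \<forall>r\<in>{0..1}. \<forall>r'\<in>{0..1}. r \<le> r' \<longrightarrow> w n r \<le> w n r') \<and>
     (\<forall>r\<in>{0<..1}. \<exists>m\<ge>1. \<forall>n\<ge>m. w (n - 1) 1 < w n r \<and> w n 1 < w (n + 1) r)"

text \<open>
  The description operator below is well defined when \<open>\<alpha>\<close> is injective, since the
  lexicographic maximiser of the pairs is then unique.
\<close>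

definition policy ::
  "('c::finite \<Rightarrow> 'c \<Rightarrow> real) \<Rightarrow> (nat \<Rightarrow> real \<Rightarrow> real) \<Rightarrow> ('c \<Rightarrow> nat) \<Rightarrow> ('c \<Rightarrow> nat) \<Rightarrow> 'c \<Rightarrow> 'c" where
  "policy \<rho> w \<alpha> x i =
     (THE j. \<forall>k. ((w (x k) (\<rho> i k), \<alpha> k), (w (x j) (\<rho> i j), \<alpha> j))
                   \<in> ({(a, b). a < b} <*lex*> {(a, b). a < b})\<^sup>=)"

text \<open>
  The point updates are \<open>x + 1\<^sub>i\<close> and \<open>x - 1\<^sub>j\<close>. For fixed \<open>x\<close> and \<open>y\<close> at most one summand
  of the two outer sums has a true guard.
\<close>

definition trans_prob ::
  "('c::finite \<Rightarrow> 'c \<Rightarrow> real) \<Rightarrow> 'c pmf \<Rightarrow> (('c \<Rightarrow> nat) \<Rightarrow> 'c \<Rightarrow> 'c) \<Rightarrow>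
     ('c \<Rightarrow> nat) \<Rightarrow> ('c \<Rightarrow> nat) \<Rightarrow> real" where
  "trans_prob \<rho> \<nu> \<phi> x y =
     (\<Sum>i\<in>UNIV. if y = x(i := x i + 1)
        then pmf \<nu> i * (1 - \<rho> i (\<phi> x i)) ^ x (\<phi> x i) else 0) +
     (\<Sum>j\<in>UNIV. if 0 < x j \<and> y = x(j := x j - 1)
        then (\<Sum>i | \<phi> x i = j. pmf \<nu> i * (1 - (1 - \<rho> i j) ^ x j)) else 0)"

definition markov_chain ::
  "'a measure \<Rightarrow> (nat \<Rightarrow> 'a \<Rightarrow> 's) \<Rightarrow> ('s \<Rightarrow> 's \<Rightarrow> real) \<Rightarrow> 's \<Rightarrow> bool" where
  "markov_chain M X P x0 \<longleftrightarrow>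
     prob_space M \<and>
     (\<forall>t. X t \<in> measurable M (count_space UNIV)) \<and>
     (AE \<omega> in M. X 0 \<omega> = x0) \<and>
     (\<forall>t y. \<P>(\<omega> in M. \<forall>s\<le>t. X s \<omega> = y s) > 0 \<longrightarrow>
        \<P>(\<omega> in M. X (Suc t) \<omega> = y (Suc t) \<bar> \<forall>s\<le>t. X s \<omega> = y s) = P (y t) (y (Suc t)))"

definition state_space :: "'a measure \<Rightarrow> (nat \<Rightarrow> 'a \<Rightarrow> 's) \<Rightarrow> 's set" where
  "state_space M X = {x. \<exists>t. \<P>(\<omega> in M. X t \<omega> = x) > 0}"

definition invariant_distribution :: "'s set \<Rightarrow> ('s \<Rightarrow> 's \<Rightarrow> real) \<Rightarrow> 's pmf \<Rightarrow> bool" where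
  "invariant_distribution S P \<pi> \<longleftrightarrow>
     set_pmf \<pi> \<subseteq> S \<and> (\<forall>y\<in>S. ((\<lambda>x. pmf \<pi> x * P x y) has_sum pmf \<pi> y) S)"

end

theory Submission
  imports Defs "HOL-Library.Diagonal_Subsequence" "HOL-Library.Discrete_Functions"
    "HOL-Real_Asymp.Real_Asymp"
begin

text \<open>
  The energy \<open>\<Sum>i. (x i)\<^sup>2\<close> has drift at most \<open>C - c * sup_norm x\<close>. Since the policy matches an arrival of
  class \<open>i\<close> with the longest queue compatible with \<open>i\<close> as soon as that queue is long, the drift is, up to
  a factor 2 and small errors, the mean length of the queues whose compatible queues are all short, minus the mean length
  of the longest compatible queue. The long queues in the first term form independent sets at every
  level, so that NCOND, applied level by level, makes the first term smaller than the second by a fixed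
  factor (\<open>independent_mass_le\<close>, \<open>energy_drift\<close>).

  Queue lengths change by bounded amounts, so squaring a Lyapunov function gives a Lyapunov function for a
  higher moment (\<open>lyapunov_square\<close>). Therefore the second moment of the Dynkin martingale of the squared
  energy grows at most linearly in time, and for indicator functions this is immediate. By Chebyshev's
  inequality these martingales are negligible along the times \<open>m\<^sup>2\<close>. This has two almost sure consequences
  along those times: the empirical measures of the chain have bounded third moments (\<open>bounded_averages_along_squares\<close>), and they are asymptotically invariant
  (\<open>balance_along_squares\<close>).

  For a fixed trajectory with these two properties, compactness finishes the argument: every subsequence of
  the empirical measures has a further subsequence that converges, together with its first moments, to an
  invariant distribution (\<open>convergent_subsequence_pmf\<close>). This gives existence and integrability. There is
  only one invariant distribution because the empty state can be reached from every state
  (\<open>reaches_empty\<close>, \<open>invariant_pmf_unique\<close>), so the averages converge along all the squares. They converge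
  along all times since partial sums of nonnegative terms are monotone (\<open>averages_tendsto_if_squares\<close>).
\<close>

section \<open>Averages of real sequences\<close>

text \<open>
  In drift estimates this absorbs an error of lower order into a small share of the leading negative term.
\<close>

lemma power_dominates:
  fixes a c :: real
  assumes "0 \<le> a" "0 < c"
  shows "\<exists>D\<ge>0. \<forall>z\<ge>0. a * (1 + z) ^ p \<le> D + c * z ^ (p + 1)"
proof -
  \<comment> \<open>beyond this point the extra factor of the higher power already beats the constants\<close>
  define z0 where "z0 = max 1 (a * 2 ^ p / c)"
  have "a * (1 + z) ^ p \<le> a * (1 + z0) ^ p + c * z ^ (p + 1)" if "0 \<le> z" for z
  proof (cases "z \<le> z0")
    case True
    then have "a * (1 + z) ^ p \<le> a * (1 + z0) ^ p"
      using that assms by (intro mult_left_mono power_mono) auto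
    moreover have "0 \<le> c * z ^ (p + 1)" using that assms by simp
    ultimately show ?thesis by linarith
  next
    case False
    then have z: "1 \<le> z" and "a * 2 ^ p / c \<le> z" by (auto simp: z0_def)
    then have cz: "a * 2 ^ p \<le> c * z" using assms(2) by (simp add: pos_divide_le_eq mult.commute)
    have "a * (1 + z) ^ p \<le> a * (2 * z) ^ p"
      using z assms by (intro mult_left_mono power_mono) auto
    also have "\<dots> = (a * 2 ^ p) * z ^ p" by (simp add: power_mult_distrib)
    also have "\<dots> \<le> (c * z) * z ^ p" using z cz by (intro mult_right_mono) auto
    also have "\<dots> \<le> a * (1 + z0) ^ p + c * z ^ (p + 1)"
      using assms by (simp add: z0_def)
    finally show ?thesis .
  qed
  moreover have "0 \<le> a * (1 + z0) ^ p" using assms by (simp add: z0_def)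
  ultimately show ?thesis by blast
qed

text \<open>
  Second moments give almost sure control only along the squares, where \<open>1 / m\<^sup>2\<close> is summable. Monotone
  partial sums are squeezed between their values at consecutive squares, whose ratio tends to 1.
\<close>

lemma averages_tendsto_if_squares:
  fixes a :: "nat \<Rightarrow> real"
  assumes nonneg: "\<And>s. 0 \<le> a s"
    and lim: "(\<lambda>m. (\<Sum>s<m\<^sup>2. a s) / real (m\<^sup>2)) \<longlonglongrightarrow> L"
  shows "(\<lambda>t. (1 / real t) * (\<Sum>s = 1..t. a s)) \<longlonglongrightarrow> L"
proof -
  define F where "F t = (\<Sum>s<t. a s)" for t
  have F_mono: "F s \<le> F t" if "s \<le> t" for s t
    unfolding F_def using that nonneg by (intro sum_mono2) auto
  have F_nonneg: "0 \<le> F t" for t unfolding F_def by (simp add: sum_nonneg nonneg)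
  define b where "b m = F (m\<^sup>2) / real (m\<^sup>2)" for m
  have b: "b \<longlonglongrightarrow> L" using lim by (simp add: b_def[abs_def] F_def)
  let ?q = "\<lambda>m::nat. (real m / real (Suc m))\<^sup>2"
  have q: "?q \<longlonglongrightarrow> 1"
    using tendsto_power[OF LIMSEQ_n_over_Suc_n, of 2] by simp
  have sq: "filterlim floor_sqrt at_top sequentially"
    unfolding filterlim_at_top
  proof
    fix Z :: nat
    show "\<forall>\<^sub>F t in sequentially. Z \<le> floor_sqrt t"
      using eventually_ge_at_top[of "Z\<^sup>2"]
    proof eventually_elim
      case (elim t)
      then have "floor_sqrt (Z\<^sup>2) \<le> floor_sqrt t" by (rule monoD[OF mono_floor_sqrt])
      then show ?case by simp
    qed
  qed
  have lo: "(\<lambda>m. b m * ?q m) \<longlonglongrightarrow> L" using tendsto_mult[OF b q] by simp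
  have hi: "(\<lambda>m. b (Suc m) / ?q m) \<longlonglongrightarrow> L"
    using tendsto_divide[OF LIMSEQ_Suc[OF b] q] by simp
  have Ft: "(\<lambda>t. F t / real t) \<longlonglongrightarrow> L"
  proof (rule tendsto_sandwich)
    show "(\<lambda>t. b (floor_sqrt t) * ?q (floor_sqrt t)) \<longlonglongrightarrow> L"
      by (rule filterlim_compose[OF lo sq])
    show "(\<lambda>t. b (Suc (floor_sqrt t)) / ?q (floor_sqrt t)) \<longlonglongrightarrow> L"
      by (rule filterlim_compose[OF hi sq])
    show "\<forall>\<^sub>F t in sequentially. b (floor_sqrt t) * ?q (floor_sqrt t) \<le> F t / real t"
      using eventually_gt_at_top[of 0]
    proof eventually_elim
      case (elim t)
      let ?m = "floor_sqrt t"
      have m: "?m\<^sup>2 \<le> t" "t < (Suc ?m)\<^sup>2" "?m > 0"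
        using elim by (auto simp: Suc_floor_sqrt_power2_gt)
      have "b ?m * ?q ?m = F (?m\<^sup>2) / real ((Suc ?m)\<^sup>2)"
        using m(3) by (simp add: b_def power_divide)
      also have "\<dots> \<le> F t / real t"
        using m elim by (intro frac_le F_mono F_nonneg) (simp_all only: of_nat_0_less_iff of_nat_le_iff less_imp_le)
      finally show ?case .
    qed
    show "\<forall>\<^sub>F t in sequentially. F t / real t \<le> b (Suc (floor_sqrt t)) / ?q (floor_sqrt t)"
      using eventually_gt_at_top[of 0]
    proof eventually_elim
      case (elim t)
      let ?m = "floor_sqrt t"
      have m: "?m\<^sup>2 \<le> t" "t < (Suc ?m)\<^sup>2" "?m > 0"
        using elim by (auto simp: Suc_floor_sqrt_power2_gt)
      have "F t / real t \<le> F ((Suc ?m)\<^sup>2) / real (?m\<^sup>2)"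
        using m elim by (intro frac_le F_mono F_nonneg) (simp_all only: of_nat_0_less_iff of_nat_le_iff less_imp_le zero_less_power)
      also have "\<dots> = b (Suc ?m) / ?q ?m"
        using m(3) by (simp add: b_def power_divide del: of_nat_Suc)
      finally show ?case .
    qed
  qed
  \<comment> \<open>the average in the claim omits index 0 and includes index \<open>t\<close>\<close>
  have "(\<lambda>t. F (Suc t) / real (Suc t) / (real t / real (Suc t)) - a 0 / real t) \<longlonglongrightarrow> L / 1 - 0"
    by (intro tendsto_diff tendsto_divide LIMSEQ_Suc[OF Ft] LIMSEQ_n_over_Suc_n lim_const_over_n) auto
  then have "(\<lambda>t. F (Suc t) / real (Suc t) / (real t / real (Suc t)) - a 0 / real t) \<longlonglongrightarrow> L" by simp
  moreover have "\<forall>\<^sub>F t in sequentially. F (Suc t) / real (Suc t) / (real t / real (Suc t)) - a 0 / real t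
      = (1 / real t) * (\<Sum>s = 1..t. a s)"
    using eventually_gt_at_top[of 0]
  proof eventually_elim
    case (elim t)
    have "F (Suc t) = a 0 + (\<Sum>s = 1..t. a s)"
      unfolding F_def lessThan_Suc_atMost atMost_atLeast0
      by (simp add: sum.atLeast_Suc_atMost)
    with elim show ?case by (simp add: field_simps del: of_nat_Suc)
  qed
  ultimately show ?thesis by (rule Lim_transform_eventually)
qed

text \<open>
  The last term of an average is the difference of two consecutive, suitably rescaled averages.
\<close>

lemma last_term_negligible:
  fixes a :: "nat \<Rightarrow> real"
  assumes lim: "(\<lambda>t. (1 / real t) * (\<Sum>s = 1..t. a s)) \<longlonglongrightarrow> L"
  shows "(\<lambda>t. a t / real t) \<longlonglongrightarrow> 0"
proof -
  define A where "A t = (1 / real t) * (\<Sum>s = 1..t. a s)" for t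
  have A: "A \<longlonglongrightarrow> L" using lim by (simp add: A_def[abs_def])
  have "(\<lambda>t. A (Suc t) - A t * (real t / real (Suc t))) \<longlonglongrightarrow> L - L * 1"
    by (intro tendsto_diff tendsto_mult LIMSEQ_Suc[OF A] A LIMSEQ_n_over_Suc_n)
  moreover have "A (Suc t) - A t * (real t / real (Suc t)) = a (Suc t) / real (Suc t)" for t
    by (cases "t = 0") (simp_all add: A_def field_simps del: of_nat_Suc)
  ultimately have "(\<lambda>t. a (Suc t) / real (Suc t)) \<longlonglongrightarrow> 0" by simp
  then show ?thesis by (rule LIMSEQ_imp_Suc)
qed

lemma tendsto_if_subsequences_tendsto:
  fixes f :: "nat \<Rightarrow> real"
  assumes sub: "\<And>r :: nat \<Rightarrow> nat. strict_mono r \<Longrightarrow> \<exists>r' :: nat \<Rightarrow> nat. strict_mono r' \<and> (\<lambda>k. f (r (r' k))) \<longlonglongrightarrow> L"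
  shows "f \<longlonglongrightarrow> L"
proof (rule ccontr)
  assume "\<not> f \<longlonglongrightarrow> L"
  then obtain e where e: "0 < e" and "\<not> (\<forall>\<^sub>F k in sequentially. dist (f k) L < e)"
    unfolding tendsto_iff by blast
  then have "infinite {k. \<not> dist (f k) L < e}"
    by (simp add: eventually_sequentially infinite_nat_iff_unbounded_le)
  from infinite_enumerate[OF this] obtain r :: "nat \<Rightarrow> nat"
    where r: "strict_mono r" "\<And>k. \<not> dist (f (r k)) L < e" by auto
  from sub[OF r(1)] obtain r' where "(\<lambda>k. f (r (r' k))) \<longlonglongrightarrow> L" by blast
  then have "\<forall>\<^sub>F k in sequentially. dist (f (r (r' k))) L < e" using e by (rule tendstoD)
  with r(2) show False by simp
qed

section \<open>Compactness of probability mass functions\<close>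

text \<open>
  Cantor's diagonal argument over the countably many points.
\<close>

lemma pointwise_convergent_subsequence:
  fixes f :: "nat \<Rightarrow> 's::countable \<Rightarrow> real"
  assumes "\<And>m y. f m y \<in> {0..1}"
  shows "\<exists>r q. strict_mono r \<and> (\<forall>y. (\<lambda>k. f (r k) y) \<longlonglongrightarrow> q y)"
proof -
  let ?P = "\<lambda>i r. convergent (\<lambda>k. f (r k) (from_nat i))"
  interpret subseqs ?P
  proof
    fix i :: nat and s :: "nat \<Rightarrow> nat"
    have "compact {0..1::real}" by simp
    then have "seq_compact {0..1::real}" by (simp add: compact_imp_seq_compact)
    then obtain l r where "strict_mono r" "((\<lambda>k. f (s k) (from_nat i)) \<circ> r) \<longlonglongrightarrow> l"
      using assms by (elim seq_compactE[where f="\<lambda>k. f (s k) (from_nat i)"]) auto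
    then show "\<exists>r'. strict_mono r' \<and> ?P i (s \<circ> r')"
      by (auto simp: convergent_def o_def)
  qed
  have "convergent (\<lambda>k. f (diagseq k) y)" for y
  proof -
    have "?P (to_nat y) (diagseq \<circ> ((+) (Suc (to_nat y))))"
    proof (rule diagseq_holds)
      fix r s :: "nat \<Rightarrow> nat" and i :: nat assume "strict_mono r" "?P i s"
      then obtain l where "(\<lambda>k. f (s k) (from_nat i)) \<longlonglongrightarrow> l" by (auto simp: convergent_def)
      from LIMSEQ_subseq_LIMSEQ[OF this \<open>strict_mono r\<close>]
      show "?P i (s \<circ> r)" by (auto simp: convergent_def o_def)
    qed
    then have "convergent (\<lambda>k. f (diagseq (k + Suc (to_nat y))) y)" by (simp add: add.commute o_def)
    then show ?thesis by (subst (asm) convergent_ignore_initial_segment)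
  qed
  then have "\<forall>y. \<exists>l. (\<lambda>k. f (diagseq k) y) \<longlonglongrightarrow> l" by (simp add: convergent_def)
  then obtain q where "\<forall>y. (\<lambda>k. f (diagseq k) y) \<longlonglongrightarrow> q y" by metis
  then show ?thesis using subseq_diagseq by blast
qed

text \<open>
  Fatou's lemma. The limit \<open>q\<close> is only a function, since mass could escape; with \<open>f = 1\<close> this bounds its total
  mass.
\<close>

lemma nn_integral_pmf_limit_le:
  fixes \<mu> :: "nat \<Rightarrow> 's pmf" and f :: "'s \<Rightarrow> real"
  assumes q: "\<And>y. (\<lambda>k. pmf (\<mu> k) y) \<longlonglongrightarrow> q y"
    and f: "\<And>y. 0 \<le> f y" and bound: "\<And>k. (\<integral>\<^sup>+y. ennreal (f y) \<partial>measure_pmf (\<mu> k)) \<le> c"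
  shows "(\<integral>\<^sup>+y. ennreal (q y) * ennreal (f y) \<partial>count_space UNIV) \<le> c"
proof -
  have lim: "(\<lambda>k. ennreal (pmf (\<mu> k) y) * ennreal (f y)) \<longlonglongrightarrow> ennreal (q y) * ennreal (f y)" for y
    unfolding ennreal_mult''[OF f, symmetric]
    by (rule tendsto_ennrealI[OF tendsto_mult[OF q tendsto_const]])
  have "(\<integral>\<^sup>+y. ennreal (q y) * ennreal (f y) \<partial>count_space UNIV) =
      (\<integral>\<^sup>+y. liminf (\<lambda>k. ennreal (pmf (\<mu> k) y) * ennreal (f y)) \<partial>count_space UNIV)"
    by (intro nn_integral_cong lim_imp_Liminf[symmetric] lim) simp
  also have "\<dots> \<le> liminf (\<lambda>k. \<integral>\<^sup>+y. ennreal (pmf (\<mu> k) y) * ennreal (f y) \<partial>count_space UNIV)"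
    by (rule nn_integral_liminf) simp
  also have "\<dots> = liminf (\<lambda>k. \<integral>\<^sup>+y. ennreal (f y) \<partial>measure_pmf (\<mu> k))"
    by (simp add: nn_integral_measure_pmf)
  also have "\<dots> \<le> liminf (\<lambda>k::nat. c)"
    by (intro Liminf_mono always_eventually allI bound)
  finally show ?thesis by (simp add: Liminf_const)
qed

text \<open>
  Where \<open>n x > R \<ge> 1\<close>, a function \<open>h\<close> of at most linear growth is at most \<open>2 * n x\<close>, hence at most
  \<open>2 * (n x ^ k) / R\<close>. A moment of order \<open>k\<close> thus gives tightness (\<open>h = 1\<close>) and uniform integrability of
  \<open>n\<close> (\<open>h = n\<close>) at once.
\<close>

lemma truncated_expectation:
  fixes p :: "'s pmf" and n :: "'s \<Rightarrow> real"
  assumes fin: "finite {x. n x \<le> R}" and n: "\<And>x. 0 \<le> n x" and "1 \<le> R" "2 \<le> k"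
    and int: "integrable (measure_pmf p) (\<lambda>x. n x ^ k)"
    and B: "measure_pmf.expectation p (\<lambda>x. n x ^ k) \<le> B"
    and h: "\<And>x. 0 \<le> h x" "\<And>x. h x \<le> 1 + n x"
  shows "integrable (measure_pmf p) h"
    and "\<bar>measure_pmf.expectation p h - (\<Sum>x | n x \<le> R. pmf p x * h x)\<bar> \<le> 2 * B / R"
proof -
  have le: "h x \<le> 2 * (n x ^ k) / R" if "R < n x" for x
  proof -
    have "h x * R \<le> (2 * n x) * n x"
      using h[of x] that \<open>1 \<le> R\<close> by (intro mult_mono) auto
    also have "\<dots> = 2 * n x ^ 2" by (simp add: power2_eq_square)
    also have "\<dots> \<le> 2 * n x ^ k"
      using that assms(3,4) by (simp add: power_increasing)
    finally show ?thesis using \<open>1 \<le> R\<close> by (simp add: field_simps)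
  qed
  have nk: "0 \<le> n x ^ k" for x using n by simp
  have "h x \<le> 2 + 2 * n x ^ k" for x
  proof (cases "n x \<le> 1")
    case True
    then show ?thesis using h(2)[of x] nk[of x] by linarith
  next
    case False
    then have "n x ^ 1 \<le> n x ^ k" using \<open>2 \<le> k\<close> by (intro power_increasing) auto
    then show ?thesis using h(2)[of x] nk[of x] by simp
  qed
  then have nh: "norm (h x) \<le> norm (2 + 2 * n x ^ k)" for x
    using h(1)[of x] nk[of x] by (simp add: abs_of_nonneg)
  have i0: "integrable (measure_pmf p) (\<lambda>x. 2 + 2 * n x ^ k)" using int by simp
  show h_int: "integrable (measure_pmf p) h"
    by (rule Bochner_Integration.integrable_bound[OF i0 _ AE_I2[OF nh]]) simp
  let ?h1 = "\<lambda>x. if n x \<le> R then h x else 0" and ?h2 = "\<lambda>x. if n x \<le> R then 0 else h x"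
  have i1: "integrable (measure_pmf p) ?h1" and i2: "integrable (measure_pmf p) ?h2"
    by (rule Bochner_Integration.integrable_bound[OF h_int]; simp add: h)+
  have "measure_pmf.expectation p h = measure_pmf.expectation p (\<lambda>x. ?h1 x + ?h2 x)"
    by (intro Bochner_Integration.integral_cong) auto
  also have "\<dots> = measure_pmf.expectation p ?h1 + measure_pmf.expectation p ?h2"
    by (rule Bochner_Integration.integral_add[OF i1 i2])
  also have "measure_pmf.expectation p ?h1 = (\<Sum>x | n x \<le> R. pmf p x * h x)"
    by (subst integral_measure_pmf[OF fin]) (auto split: if_splits intro!: sum.cong)
  finally have eq: "measure_pmf.expectation p h - (\<Sum>x | n x \<le> R. pmf p x * h x)
      = measure_pmf.expectation p ?h2" by simp
  have "measure_pmf.expectation p ?h2 \<le> measure_pmf.expectation p (\<lambda>x. 2 * (n x ^ k) / R)"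
    using le nk \<open>1 \<le> R\<close> int by (intro integral_mono i2) auto
  also have "\<dots> = 2 * measure_pmf.expectation p (\<lambda>x. n x ^ k) / R" by simp
  also have "\<dots> \<le> 2 * B / R" using B \<open>1 \<le> R\<close> by (intro divide_right_mono) auto
  finally have "measure_pmf.expectation p ?h2 \<le> 2 * B / R" .
  moreover have "0 \<le> measure_pmf.expectation p ?h2" by (simp add: h)
  ultimately show "\<bar>measure_pmf.expectation p h - (\<Sum>x | n x \<le> R. pmf p x * h x)\<bar> \<le> 2 * B / R"
    unfolding eq by linarith
qed

text \<open>
  Prokhorov's theorem on a countable space, where \<open>n\<close> has finite sublevel sets, with convergence of the first
  moment as well: a bound on a moment of order at least 2 prevents both mass and first moment from escaping to
  infinity.
\<close>

lemma convergent_subsequence_pmf: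
  fixes \<mu> :: "nat \<Rightarrow> 's::countable pmf" and n :: "'s \<Rightarrow> real"
  assumes fin: "\<And>R. finite {x. n x \<le> R}" and n: "\<And>x. 0 \<le> n x" and k: "2 \<le> k"
    and int: "\<And>m. integrable (measure_pmf (\<mu> m)) (\<lambda>x. n x ^ k)"
    and B: "\<And>m. measure_pmf.expectation (\<mu> m) (\<lambda>x. n x ^ k) \<le> B"
  shows "\<exists>r \<pi>. strict_mono r \<and> (\<forall>y. (\<lambda>m. pmf (\<mu> (r m)) y) \<longlonglongrightarrow> pmf \<pi> y) \<and>
    integrable (measure_pmf \<pi>) n \<and>
    (\<lambda>m. measure_pmf.expectation (\<mu> (r m)) n) \<longlonglongrightarrow> measure_pmf.expectation \<pi> n"
proof -
  obtain r q where r: "strict_mono r" and q: "\<And>y. (\<lambda>m. pmf (\<mu> (r m)) y) \<longlonglongrightarrow> q y"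
    using pointwise_convergent_subsequence[of "\<lambda>m. pmf (\<mu> m)"] by (auto simp: pmf_nonneg pmf_le_1)
  have q0: "0 \<le> q y" for y
    by (rule LIMSEQ_le_const[OF q]) (simp add: pmf_nonneg)
  have B0: "0 \<le> B" by (rule order_trans[OF _ B[of 0]]) (simp add: n)
  have mass_R: "1 - 2 * B / R \<le> (\<Sum>x | n x \<le> R. q x)" if R: "1 \<le> R" for R
  proof (rule LIMSEQ_le_const)
    show "(\<lambda>m. \<Sum>x | n x \<le> R. pmf (\<mu> (r m)) x) \<longlonglongrightarrow> (\<Sum>x | n x \<le> R. q x)"
      by (intro tendsto_sum q)
    have "1 - 2 * B / R \<le> (\<Sum>x | n x \<le> R. pmf (\<mu> (r m)) x)" for m
      using truncated_expectation(2)[OF fin n R k int B, where h="\<lambda>_. 1", of "r m"] n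
      by (simp add: measure_pmf.prob_space abs_le_iff)
    then show "\<exists>N. \<forall>m\<ge>N. 1 - 2 * B / R \<le> (\<Sum>x | n x \<le> R. pmf (\<mu> (r m)) x)" by blast
  qed
  have "(\<integral>\<^sup>+y. ennreal (q y) \<partial>count_space UNIV) \<le> 1"
    using nn_integral_pmf_limit_le[OF q, of "\<lambda>_. 1" 1] by simp
  moreover have "1 \<le> (\<integral>\<^sup>+y. ennreal (q y) \<partial>count_space UNIV)"
  proof (rule LIMSEQ_le_const2)
    have "(\<lambda>m. 2 * B / real (Suc m)) \<longlonglongrightarrow> 0"
      by (rule LIMSEQ_Suc[OF lim_const_over_n])
    from tendsto_ennrealI[OF tendsto_diff[OF tendsto_const[of 1] this]]
    show "(\<lambda>m. ennreal (1 - 2 * B / real (Suc m))) \<longlonglongrightarrow> 1" by simp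
    have "ennreal (1 - 2 * B / real (Suc m)) \<le> (\<integral>\<^sup>+y. ennreal (q y) \<partial>count_space UNIV)" for m
    proof -
      have "ennreal (1 - 2 * B / real (Suc m)) \<le> ennreal (\<Sum>x | n x \<le> real (Suc m). q x)"
        by (intro ennreal_leI mass_R) simp
      also have "\<dots> = (\<Sum>x | n x \<le> real (Suc m). ennreal (q x))"
        by (simp add: sum_ennreal q0)
      also have "\<dots> = (\<integral>\<^sup>+y. ennreal (q y) \<partial>count_space {x. n x \<le> real (Suc m)})"
        by (simp add: nn_integral_count_space_finite fin)
      also have "\<dots> = (\<integral>\<^sup>+y. ennreal (q y) * indicator {x. n x \<le> real (Suc m)} y \<partial>count_space UNIV)"
        by (rule nn_integral_count_space_indicator) simp
      also have "\<dots> \<le> (\<integral>\<^sup>+y. ennreal (q y) \<partial>count_space UNIV)"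
        by (rule nn_integral_mono) (simp add: indicator_def)
      finally show ?thesis .
    qed
    then show "\<exists>N. \<forall>m\<ge>N. ennreal (1 - 2 * B / real (Suc m)) \<le> (\<integral>\<^sup>+y. ennreal (q y) \<partial>count_space UNIV)"
      by blast
  qed
  ultimately have q1: "(\<integral>\<^sup>+y. ennreal (q y) \<partial>count_space UNIV) = 1" by (rule order_antisym)
  \<comment> \<open>no mass was lost, so the limit is a probability mass function\<close>
  define \<pi> where "\<pi> = embed_pmf q"
  have \<pi>: "pmf \<pi> y = q y" for y unfolding \<pi>_def by (rule pmf_embed_pmf[OF q0 q1])
  have "(\<integral>\<^sup>+x. ennreal (n x ^ k) \<partial>measure_pmf \<pi>) \<le> ennreal B"
  proof -
    have "(\<integral>\<^sup>+x. ennreal (n x ^ k) \<partial>measure_pmf (\<mu> (r m))) \<le> ennreal B" for m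
      by (subst nn_integral_eq_integral[OF int]) (use n B in \<open>auto intro!: ennreal_leI\<close>)
    from nn_integral_pmf_limit_le[OF q _ this] show ?thesis
      by (simp add: nn_integral_measure_pmf \<pi> n)
  qed
  then have int\<pi>: "integrable (measure_pmf \<pi>) (\<lambda>x. n x ^ k)"
    and B\<pi>: "measure_pmf.expectation \<pi> (\<lambda>x. n x ^ k) \<le> B"
  proof -
    assume le: "(\<integral>\<^sup>+x. ennreal (n x ^ k) \<partial>measure_pmf \<pi>) \<le> ennreal B"
    show i: "integrable (measure_pmf \<pi>) (\<lambda>x. n x ^ k)"
      by (rule integrableI_bounded) (use le n in \<open>auto simp: abs_of_nonneg intro: le_less_trans\<close>)
    show "measure_pmf.expectation \<pi> (\<lambda>x. n x ^ k) \<le> B"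
      using le B0 by (subst (asm) nn_integral_eq_integral[OF i]) (auto simp: n)
  qed
  have n_le: "n x \<le> 1 + n x" for x by simp
  have "(\<lambda>m. measure_pmf.expectation (\<mu> (r m)) n) \<longlonglongrightarrow> measure_pmf.expectation \<pi> n"
  proof (rule LIMSEQ_I)
    fix e :: real assume e: "0 < e"
    \<comment> \<open>both truncation errors are then at most \<open>e / 4\<close>, leaving room for the finite sums\<close>
    define R where "R = max 1 (8 * B / e)"
    have R: "1 \<le> R" and "8 * B / e \<le> R" by (auto simp: R_def)
    then have R2: "2 * B / R \<le> e / 4" using e by (simp add: field_simps)
    have "(\<lambda>m. \<Sum>x | n x \<le> R. pmf (\<mu> (r m)) x * n x) \<longlonglongrightarrow> (\<Sum>x | n x \<le> R. pmf \<pi> x * n x)"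
      unfolding \<pi> by (intro tendsto_intros q)
    from LIMSEQ_D[OF this, of "e / 4"] e obtain N where
      N: "\<And>m. m \<ge> N \<Longrightarrow> \<bar>(\<Sum>x | n x \<le> R. pmf (\<mu> (r m)) x * n x) - (\<Sum>x | n x \<le> R. pmf \<pi> x * n x)\<bar> < e / 4"
      by auto
    have "\<bar>measure_pmf.expectation (\<mu> (r m)) n - measure_pmf.expectation \<pi> n\<bar> < e" if "m \<ge> N" for m
      using N[OF that] truncated_expectation(2)[OF fin n R k int B n n_le, of "r m"]
        truncated_expectation(2)[OF fin n R k int\<pi> B\<pi> n n_le] R2 e
      by linarith
    then show "\<exists>N. \<forall>m\<ge>N. norm (measure_pmf.expectation (\<mu> (r m)) n - measure_pmf.expectation \<pi> n) < e"
      by auto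
  qed
  moreover have "integrable (measure_pmf \<pi>) n"
    by (rule truncated_expectation(1)[OF fin n order_refl k int\<pi> B\<pi> n n_le])
  ultimately show ?thesis using r q by (intro exI[of _ r] exI[of _ \<pi>]) (simp add: \<pi>)
qed

lemma eq_if_nn_integral_le:
  fixes f g :: "'s \<Rightarrow> ennreal"
  assumes le: "\<And>x. f x \<le> g x"
    and ge: "(\<integral>\<^sup>+x. g x \<partial>count_space UNIV) \<le> (\<integral>\<^sup>+x. f x \<partial>count_space UNIV)"
    and fin: "(\<integral>\<^sup>+x. g x \<partial>count_space UNIV) \<noteq> \<infinity>"
  shows "f x = g x"
proof -
  have fg: "(\<integral>\<^sup>+x. f x \<partial>count_space UNIV) \<le> (\<integral>\<^sup>+x. g x \<partial>count_space UNIV)"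
    by (intro nn_integral_mono le)
  have "(\<integral>\<^sup>+x. g x - f x \<partial>count_space UNIV) =
      (\<integral>\<^sup>+x. g x \<partial>count_space UNIV) - (\<integral>\<^sup>+x. f x \<partial>count_space UNIV)"
    using fin fg le by (intro nn_integral_diff) (auto simp: top_unique)
  also have "\<dots> = 0" using ge fin by (simp add: diff_eq_0_iff_ennreal less_top)
  finally have "g x - f x = 0"
    by (simp add: nn_integral_0_iff_AE AE_count_space)
  then have "g x \<le> f x" by (simp add: diff_eq_0_iff_ennreal)
  with le[of x] show ?thesis by (rule order_antisym)
qed

section \<open>Kernels with finite steps\<close>

locale finite_step_kernel =
  fixes K :: "'s::countable \<Rightarrow> 's pmf"
  assumes finite_step: "finite (set_pmf (K x))"
begin

abbreviation step_mean :: "('s \<Rightarrow> real) \<Rightarrow> 's \<Rightarrow> real" where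
  "step_mean h x \<equiv> measure_pmf.expectation (K x) h"

lemma integrable_step: "integrable (measure_pmf (K x)) (h :: 's \<Rightarrow> real)"
  by (rule integrable_measure_pmf_finite[OF finite_step])

lemma step_mean_mono: "(\<And>y. y \<in> set_pmf (K x) \<Longrightarrow> h y \<le> h' y) \<Longrightarrow> step_mean h x \<le> step_mean h' x"
  by (rule integral_mono_AE) (auto simp: integrable_step AE_measure_pmf_iff)

text \<open>
  The law of the trajectory up to time \<open>t\<close>. The most recent state comes first, so that \<open>hd\<close> is the current
  state and a step is a \<open>Cons\<close>. Its support is finite, so every function of a finite history is integrable.
\<close>

primrec path_law :: "'s \<Rightarrow> nat \<Rightarrow> 's list pmf" where
  "path_law x0 0 = return_pmf [x0]"
| "path_law x0 (Suc t) = path_law x0 t \<bind> (\<lambda>p. map_pmf (\<lambda>y. y # p) (K (hd p)))"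

lemma finite_path_law: "finite (set_pmf (path_law x0 t))"
  by (induction t) (auto simp: finite_step)

lemma integrable_path_law: "integrable (measure_pmf (path_law x0 t)) (F :: 's list \<Rightarrow> real)"
  by (rule integrable_measure_pmf_finite[OF finite_path_law])

lemma path_law_nonempty: "p \<in> set_pmf (path_law x0 t) \<Longrightarrow> p \<noteq> []"
  by (cases t) auto

lemma expectation_path_law_Suc:
  fixes F :: "'s list \<Rightarrow> real"
  shows "measure_pmf.expectation (path_law x0 (Suc t)) F =
    measure_pmf.expectation (path_law x0 t) (\<lambda>p. step_mean (\<lambda>y. F (y # p)) (hd p))"
proof -
  have "measure_pmf.expectation (path_law x0 (Suc t)) F =
      (\<Sum>p\<in>set_pmf (path_law x0 t). pmf (path_law x0 t) p *\<^sub>R step_mean (\<lambda>y. F (y # p)) (hd p))"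
    by (simp add: pmf_expectation_bind[OF finite_path_law _ order_refl] finite_step)
  then show ?thesis
    by (simp add: integral_measure_pmf[OF finite_path_law])
qed

lemma pmf_path_law_Suc:
  "pmf (path_law x0 (Suc t)) (y # p) = pmf (path_law x0 t) p * pmf (K (hd p)) y"
proof -
  have "pmf (map_pmf (\<lambda>y. y # q) (K (hd q))) (y # p) = (if q = p then pmf (K (hd p)) y else 0)" for q
  proof (cases "q = p")
    case True
    then show ?thesis
      using pmf_map_inj'[of "\<lambda>y. y # p" "K (hd p)" y] by (simp add: inj_def)
  next
    case False
    then show ?thesis by (auto simp: pmf_eq_0_set_pmf)
  qed
  then have "pmf (path_law x0 (Suc t)) (y # p) =
      measure_pmf.expectation (path_law x0 t) (\<lambda>q. if q = p then pmf (K (hd p)) y else 0)"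
    by (simp add: pmf_bind)
  also have "\<dots> = pmf (path_law x0 t) p * pmf (K (hd p)) y"
    by (subst integral_measure_pmf[of "{p}"]) (auto split: if_splits)
  finally show ?thesis .
qed

text \<open>
  The Dynkin martingale of \<open>h\<close>, as a function of the history: the sum of the increments of \<open>h\<close> minus their
  conditional means.
\<close>

fun martingale :: "('s \<Rightarrow> real) \<Rightarrow> 's list \<Rightarrow> real" where
  "martingale h [] = 0"
| "martingale h [x] = 0"
| "martingale h (y # x # p) = martingale h (x # p) + (h y - step_mean h x)"

lemma martingale_Cons: "p \<noteq> [] \<Longrightarrow> martingale h (y # p) = martingale h p + (h y - step_mean h (hd p))"
  by (cases p) auto

text \<open>
  Martingale increments are orthogonal, so their second moments add up. Each of them is a conditional variance,
  which is at most the second moment about the current value of \<open>h\<close>.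
\<close>

lemma expectation_martingale_square:
  assumes v: "\<And>x. step_mean (\<lambda>y. (h y - h x)\<^sup>2) x \<le> v x"
  shows "measure_pmf.expectation (path_law x0 t) (\<lambda>p. (martingale h p)\<^sup>2) \<le>
    (\<Sum>s<t. measure_pmf.expectation (path_law x0 s) (\<lambda>p. v (hd p)))"
proof (induction t)
  case (Suc t)
  have var: "step_mean (\<lambda>y. (h y - step_mean h x)\<^sup>2) x \<le> v x" for x
  proof -
    have "step_mean (\<lambda>y. (h y - step_mean h x)\<^sup>2) x =
        step_mean (\<lambda>y. (h y - h x)\<^sup>2) x - (step_mean h x - h x)\<^sup>2"
    proof -
      have "step_mean (\<lambda>y. (h y - step_mean h x)\<^sup>2) x =
          step_mean (\<lambda>y. (h y - h x)\<^sup>2 - 2 * (step_mean h x - h x) * h y + ((step_mean h x)\<^sup>2 - (h x)\<^sup>2)) x"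
        by (intro Bochner_Integration.integral_cong) (auto simp: power2_eq_square algebra_simps)
      also have "\<dots> = step_mean (\<lambda>y. (h y - h x)\<^sup>2) x - 2 * (step_mean h x - h x) * step_mean h x + ((step_mean h x)\<^sup>2 - (h x)\<^sup>2)"
        by (simp add: integrable_step measure_pmf.prob_space)
      also have "\<dots> = step_mean (\<lambda>y. (h y - h x)\<^sup>2) x - (step_mean h x - h x)\<^sup>2"
        by (simp add: power2_eq_square algebra_simps)
      finally show ?thesis .
    qed
    with v[of x] show ?thesis by (smt (verit) zero_le_power2)
  qed
  have "measure_pmf.expectation (path_law x0 (Suc t)) (\<lambda>p. (martingale h p)\<^sup>2) =
      measure_pmf.expectation (path_law x0 t) (\<lambda>p. step_mean (\<lambda>y. (martingale h (y # p))\<^sup>2) (hd p))"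
    by (rule expectation_path_law_Suc)
  also have "\<dots> \<le> measure_pmf.expectation (path_law x0 t) (\<lambda>p. (martingale h p)\<^sup>2 + v (hd p))"
  proof (intro integral_mono_AE integrable_path_law, unfold AE_measure_pmf_iff, intro ballI)
    fix p assume "p \<in> set_pmf (path_law x0 t)"
    then have [simp]: "p \<noteq> []" by (rule path_law_nonempty)
    have "step_mean (\<lambda>y. (martingale h (y # p))\<^sup>2) (hd p) =
        step_mean (\<lambda>y. (martingale h p)\<^sup>2 + 2 * martingale h p * (h y - step_mean h (hd p)) + (h y - step_mean h (hd p))\<^sup>2) (hd p)"
      by (intro Bochner_Integration.integral_cong) (auto simp: martingale_Cons power2_eq_square algebra_simps)
    also have "\<dots> = (martingale h p)\<^sup>2 + step_mean (\<lambda>y. (h y - step_mean h (hd p))\<^sup>2) (hd p)"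
      by (simp add: integrable_step measure_pmf.prob_space)
    finally show "step_mean (\<lambda>y. (martingale h (y # p))\<^sup>2) (hd p) \<le> (martingale h p)\<^sup>2 + v (hd p)"
      using var[of "hd p"] by simp
  qed
  also have "\<dots> = measure_pmf.expectation (path_law x0 t) (\<lambda>p. (martingale h p)\<^sup>2) +
      measure_pmf.expectation (path_law x0 t) (\<lambda>p. v (hd p))"
    by (simp add: integrable_path_law)
  finally show ?case using Suc by simp
qed simp

text \<open>
  The expected values of \<open>U\<close> telescope along the trajectory, and the last one is nonnegative.
\<close>

lemma expectation_drift:
  assumes U: "\<And>x. 0 \<le> U x" and drift: "\<And>x. step_mean U x \<le> U x + C - g x"
  shows "(\<Sum>s<t. measure_pmf.expectation (path_law x0 s) (\<lambda>p. g (hd p))) \<le> C * t + U x0"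
proof -
  have "measure_pmf.expectation (path_law x0 t) (\<lambda>p. U (hd p)) +
    (\<Sum>s<t. measure_pmf.expectation (path_law x0 s) (\<lambda>p. g (hd p))) \<le> C * t + U x0"
  proof (induction t)
    case (Suc t)
    have "measure_pmf.expectation (path_law x0 (Suc t)) (\<lambda>p. U (hd p)) =
        measure_pmf.expectation (path_law x0 t) (\<lambda>p. step_mean U (hd p))"
      by (subst expectation_path_law_Suc) simp
    also have "\<dots> \<le> measure_pmf.expectation (path_law x0 t) (\<lambda>p. U (hd p) + C - g (hd p))"
      by (intro integral_mono_AE integrable_path_law) (auto simp: drift)
    also have "\<dots> = measure_pmf.expectation (path_law x0 t) (\<lambda>p. U (hd p)) + C
        - measure_pmf.expectation (path_law x0 t) (\<lambda>p. g (hd p))"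
      by (simp add: integrable_path_law measure_pmf.prob_space)
    finally show ?case using Suc by (simp add: algebra_simps)
  qed simp
  moreover have "0 \<le> measure_pmf.expectation (path_law x0 t) (\<lambda>p. U (hd p))"
    by (simp add: U)
  ultimately show ?thesis by linarith
qed

primrec history :: "(nat \<Rightarrow> 'a \<Rightarrow> 's) \<Rightarrow> nat \<Rightarrow> 'a \<Rightarrow> 's list" where
  "history X 0 \<omega> = [X 0 \<omega>]"
| "history X (Suc t) \<omega> = X (Suc t) \<omega> # history X t \<omega>"

lemma hd_history [simp]: "hd (history X t \<omega>) = X t \<omega>"
  by (cases t) auto

lemma history_nonempty [simp]: "history X t \<omega> \<noteq> []"
  by (cases t) auto

lemma length_history [simp]: "length (history X t \<omega>) = Suc t"
  by (induction t) auto

lemma history_eq_iff: "length p = Suc t \<Longrightarrow> history X t \<omega> = p \<longleftrightarrow> (\<forall>s\<le>t. X s \<omega> = p ! (t - s))"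
proof (induction t arbitrary: p)
  case 0
  then show ?case by (cases p) auto
next
  case (Suc t)
  then obtain y q where p: "p = y # q" "length q = Suc t" by (cases p) auto
  have "(\<forall>s\<le>Suc t. X s \<omega> = p ! (Suc t - s)) \<longleftrightarrow>
      X (Suc t) \<omega> = y \<and> (\<forall>s\<le>t. X s \<omega> = q ! (t - s))"
    unfolding p le_Suc_eq by (auto simp: Suc_diff_le)
  then show ?case using Suc.IH[OF p(2)] p by auto
qed

lemma martingale_history:
  "martingale h (history X t \<omega>) = h (X t \<omega>) - h (X 0 \<omega>) - (\<Sum>s<t. step_mean h (X s \<omega>) - h (X s \<omega>))"
  by (induction t) (auto simp: martingale_Cons)

lemma invariant_nn_integral:
  assumes "bind_pmf p K = p"
  shows "ennreal (pmf p y) = (\<integral>\<^sup>+x. ennreal (pmf p x) * ennreal (pmf (K x) y) \<partial>count_space UNIV)"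
  by (subst assms[symmetric]) (simp add: ennreal_pmf_bind nn_integral_measure_pmf)

text \<open>
  The pointwise minimum of two invariant distributions is mapped by the kernel to something below itself. The
  kernel preserves total mass, so the minimum is invariant, and then so is the excess of \<open>p\<close> over it. An
  invariant excess that is positive at \<open>x\<close> is positive at every state that \<open>x\<close> leads to.
\<close>

lemma invariant_pmf_not_dominated:
  assumes p: "bind_pmf p K = p" and q: "bind_pmf q K = q"
    and reach: "\<And>x. (x, x0) \<in> {(x, y). y \<in> set_pmf (K x)}\<^sup>*"
    and x: "pmf q x < pmf p x"
  shows "pmf q x0 < pmf p x0"
proof -
  define m where "m x = min (pmf p x) (pmf q x)" for x
  have m0: "0 \<le> m x" for x by (simp add: m_def pmf_nonneg)
  let ?mK = "\<lambda>y. \<integral>\<^sup>+x. ennreal (m x) * ennreal (pmf (K x) y) \<partial>count_space UNIV"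
  have le: "?mK y \<le> ennreal (m y)" for y
  proof -
    have "?mK y \<le> ennreal (pmf p y)" "?mK y \<le> ennreal (pmf q y)"
      unfolding invariant_nn_integral[OF p, of y] invariant_nn_integral[OF q, of y]
      by (intro nn_integral_mono mult_right_mono ennreal_leI; simp add: m_def)+
    then show ?thesis by (cases "pmf p y \<le> pmf q y") (auto simp: m_def min_def)
  qed
  have one: "(\<integral>\<^sup>+y. ennreal (pmf r y) \<partial>count_space UNIV) = 1" for r :: "'s pmf"
    by (simp add: nn_integral_pmf)
  have "(\<integral>\<^sup>+y. ?mK y \<partial>count_space UNIV) =
      (\<integral>\<^sup>+x. \<integral>\<^sup>+y. ennreal (m x) * ennreal (pmf (K x) y) \<partial>count_space UNIV \<partial>count_space UNIV)"
    using nn_integral_fst_count_space[of "\<lambda>(x, y). ennreal (m x) * ennreal (pmf (K x) y)"]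
      nn_integral_snd_count_space[of "\<lambda>(x, y). ennreal (m x) * ennreal (pmf (K x) y)"]
    by simp
  also have "\<dots> = (\<integral>\<^sup>+x. ennreal (m x) \<partial>count_space UNIV)"
    by (simp add: nn_integral_cmult one)
  finally have total: "(\<integral>\<^sup>+y. ?mK y \<partial>count_space UNIV) = (\<integral>\<^sup>+x. ennreal (m x) \<partial>count_space UNIV)" .
  have "(\<integral>\<^sup>+x. ennreal (m x) \<partial>count_space UNIV) \<le> 1"
    unfolding one[of p, symmetric] by (intro nn_integral_mono ennreal_leI) (simp add: m_def)
  then have m_inv: "?mK y = ennreal (m y)" for y
    by (intro eq_if_nn_integral_le[where f="?mK"] le) (auto simp: total top_unique)
  have step: "m y < pmf p y" if x: "m x < pmf p x" and y: "y \<in> set_pmf (K x)" for x y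
  proof (rule ccontr)
    assume "\<not> m y < pmf p y"
    then have eq: "m y = pmf p y" by (simp add: m_def min_def split: if_splits)
    have "ennreal (m x) * ennreal (pmf (K x) y) = ennreal (pmf p x) * ennreal (pmf (K x) y)"
    proof (rule eq_if_nn_integral_le[where x=x])
      show "(\<integral>\<^sup>+x. ennreal (pmf p x) * ennreal (pmf (K x) y) \<partial>count_space UNIV) \<le> ?mK y"
        unfolding m_inv eq invariant_nn_integral[OF p, symmetric] ..
      show "(\<integral>\<^sup>+x. ennreal (pmf p x) * ennreal (pmf (K x) y) \<partial>count_space UNIV) \<noteq> \<infinity>"
        unfolding invariant_nn_integral[OF p, symmetric] by simp
      show "ennreal (m x) * ennreal (pmf (K x) y) \<le> ennreal (pmf p x) * ennreal (pmf (K x) y)" for x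
        by (intro mult_right_mono ennreal_leI) (auto simp: m_def)
    qed
    then have "m x * pmf (K x) y = pmf p x * pmf (K x) y"
      by (simp add: ennreal_mult'[symmetric] m0 pmf_nonneg)
    with x y show False by (simp add: pmf_eq_0_set_pmf)
  qed
  have "m x < pmf p x" using x by (simp add: m_def)
  with reach[of x] have "m x0 < pmf p x0"
    by (induction rule: converse_rtrancl_induct) (auto dest: step)
  then show ?thesis by (simp add: m_def min_def split: if_splits)
qed

text \<open>
  Two different distributions exceed each other somewhere, so each would exceed the other at \<open>x0\<close>.
\<close>

lemma invariant_pmf_unique:
  assumes "bind_pmf p K = p" "bind_pmf q K = q"
    and "\<And>x. (x, x0) \<in> {(x, y). y \<in> set_pmf (K x)}\<^sup>*"
  shows "p = q"
proof (rule ccontr)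
  assume "p \<noteq> q"
  then obtain x y where "pmf q x < pmf p x" "pmf p y < pmf q y"
    using pmf_neq_exists_less by metis
  then show False
    using invariant_pmf_not_dominated[OF assms, of x]
      invariant_pmf_not_dominated[OF assms(2,1,3), of y] by simp
qed

text \<open>
  Here \<open>n\<close> measures the size of a state. The function \<open>U\<close> is of order \<open>k + 1\<close> in \<open>n\<close>, while its increments and
  its negative drift are of order \<open>k\<close>. Tying the orders together in this way means that squaring leads
  to a function of the same kind, of order \<open>2 * k + 1\<close>.
\<close>

definition lyapunov :: "('s \<Rightarrow> real) \<Rightarrow> nat \<Rightarrow> ('s \<Rightarrow> real) \<Rightarrow> bool" where
  "lyapunov n k U \<longleftrightarrow>
     (\<forall>x. 0 \<le> U x) \<and>
     (\<exists>A\<ge>0. \<forall>x. U x \<le> A * (1 + n x) ^ (k + 1)) \<and>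
     (\<exists>b\<ge>0. \<forall>x. \<forall>y\<in>set_pmf (K x). \<bar>U y - U x\<bar> \<le> b * (1 + n x) ^ k) \<and>
     (\<forall>x. n x ^ (k + 1) \<le> U x) \<and>
     (\<exists>C\<ge>0. \<exists>c>0. \<forall>x. step_mean U x \<le> U x + C - c * n x ^ k)"

text \<open>
  In \<open>(U y)\<^sup>2 = (U x)\<^sup>2 + 2 * U x * (U y - U x) + (U y - U x)\<^sup>2\<close>, the linear term has mean of order
  \<open>- n x ^ (2 * k + 1)\<close> by the drift of \<open>U\<close>, and the last term is only of order \<open>n x ^ (2 * k)\<close>.
\<close>

lemma lyapunov_square:
  assumes n: "\<And>x. 0 \<le> n x" and k: "1 \<le> k" and lyap: "lyapunov n k U"
  shows "lyapunov n (2 * k + 1) (\<lambda>x. (U x)\<^sup>2)"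
proof -
  from lyap obtain A b C c where U0: "\<And>x. 0 \<le> U x" and A: "0 \<le> A" "\<And>x. U x \<le> A * (1 + n x) ^ (k + 1)"
    and b: "0 \<le> b" "\<And>x y. y \<in> set_pmf (K x) \<Longrightarrow> \<bar>U y - U x\<bar> \<le> b * (1 + n x) ^ k"
    and low: "\<And>x. n x ^ (k + 1) \<le> U x"
    and c: "0 \<le> C" "0 < c" "\<And>x. step_mean U x \<le> U x + C - c * n x ^ k"
    unfolding lyapunov_def by metis
  have n1: "1 \<le> 1 + n x" for x using n[of x] by simp
  have split_power: "z ^ (2 * k + 1) = z ^ k * z ^ (k + 1)" for z :: real
    by (simp add: mult_2 power_add)
  have sq_le: "(U x)\<^sup>2 \<le> A\<^sup>2 * (1 + n x) ^ (2 * k + 1 + 1)" for x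
  proof -
    have "(U x)\<^sup>2 \<le> (A * (1 + n x) ^ (k + 1))\<^sup>2" by (intro power_mono A U0)
    also have "\<dots> = A\<^sup>2 * (1 + n x) ^ ((k + 1) * 2)"
      by (simp only: power_mult_distrib power_mult)
    also have "(k + 1) * 2 = 2 * k + 1 + 1" by simp
    finally show ?thesis .
  qed
  have low_sq: "n x ^ (2 * k + 1 + 1) \<le> (U x)\<^sup>2" for x
  proof -
    have "2 * k + 1 + 1 = (k + 1) * 2" by simp
    then have "n x ^ (2 * k + 1 + 1) = (n x ^ (k + 1))\<^sup>2" by (simp only: power_mult)
    also have "\<dots> \<le> (U x)\<^sup>2" by (intro power_mono low) (simp add: n)
    finally show ?thesis .
  qed
  have incr: "\<bar>(U y)\<^sup>2 - (U x)\<^sup>2\<bar> \<le> (b * (2 * A + b)) * (1 + n x) ^ (2 * k + 1)"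
    if y: "y \<in> set_pmf (K x)" for x y
  proof -
    have bk: "b * (1 + n x) ^ k \<le> b * (1 + n x) ^ (k + 1)"
      using b(1) n1[of x] by (intro mult_left_mono power_increasing) auto
    have "\<bar>(U y)\<^sup>2 - (U x)\<^sup>2\<bar> = \<bar>U y - U x\<bar> * (U y + U x)"
      using U0[of x] U0[of y] by (simp add: power2_eq_square square_diff_square_factored abs_mult)
    also have "\<dots> \<le> (b * (1 + n x) ^ k) * ((2 * A + b) * (1 + n x) ^ (k + 1))"
    proof (intro mult_mono b y)
      show "U y + U x \<le> (2 * A + b) * (1 + n x) ^ (k + 1)"
        using b(2)[OF y] A(2)[of x] bk unfolding distrib_right by linarith
    qed (use b n1[of x] U0[of x] U0[of y] in auto)
    also have "\<dots> = (b * (2 * A + b)) * (1 + n x) ^ (2 * k + 1)"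
      unfolding split_power by (simp only: mult_ac)
    finally show ?thesis .
  qed
  define a where "a = 2 * A * C + b\<^sup>2"
  have a0: "0 \<le> a" using A c by (simp add: a_def)
  obtain D where D: "0 \<le> D" "\<And>z. 0 \<le> z \<Longrightarrow> a * (1 + z) ^ (2 * k) \<le> D + c * z ^ (2 * k + 1)"
    using power_dominates[OF a0 c(2), of "2 * k"] by blast
  have drift: "step_mean (\<lambda>y. (U y)\<^sup>2) x \<le> (U x)\<^sup>2 + D - c * n x ^ (2 * k + 1)" for x
  proof -
    have "step_mean (\<lambda>y. (U y)\<^sup>2) x \<le> step_mean (\<lambda>y. (U x)\<^sup>2 + 2 * U x * (U y - U x) + (b * (1 + n x) ^ k)\<^sup>2) x"
    proof (rule step_mean_mono)
      fix y assume "y \<in> set_pmf (K x)"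
      then have "(U y - U x)\<^sup>2 \<le> (b * (1 + n x) ^ k)\<^sup>2"
        using b by (metis abs_ge_zero power2_abs power_mono)
      then show "(U y)\<^sup>2 \<le> (U x)\<^sup>2 + 2 * U x * (U y - U x) + (b * (1 + n x) ^ k)\<^sup>2"
        by (simp add: power2_eq_square algebra_simps)
    qed
    also have "\<dots> = (U x)\<^sup>2 + 2 * U x * (step_mean U x - U x) + (b * (1 + n x) ^ k)\<^sup>2"
      by (simp add: integrable_step measure_pmf.prob_space)
    also have "\<dots> \<le> (U x)\<^sup>2 + 2 * U x * (C - c * n x ^ k) + b\<^sup>2 * (1 + n x) ^ (2 * k)"
    proof -
      have "2 * U x * (step_mean U x - U x) \<le> 2 * U x * (C - c * n x ^ k)"
        using c(3)[of x] U0[of x] by (intro mult_left_mono) auto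
      then show ?thesis by (simp add: power_mult_distrib power_mult[symmetric] mult.commute)
    qed
    also have "\<dots> \<le> (U x)\<^sup>2 + a * (1 + n x) ^ (2 * k) - 2 * c * n x ^ (2 * k + 1)"
    proof -
      have "U x * C \<le> A * C * (1 + n x) ^ (2 * k)"
      proof -
        have "U x \<le> A * (1 + n x) ^ (k + 1)" by (rule A)
        also have "\<dots> \<le> A * (1 + n x) ^ (2 * k)"
          using A(1) n1[of x] k by (intro mult_left_mono power_increasing) auto
        finally show ?thesis using c(1) by (metis mult.assoc mult.commute mult_right_mono)
      qed
      moreover have "c * n x ^ (2 * k + 1) \<le> U x * (c * n x ^ k)"
      proof -
        have "n x ^ (k + 1) * (c * n x ^ k) \<le> U x * (c * n x ^ k)"
          using low n c by (intro mult_right_mono) auto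
        then show ?thesis unfolding split_power by (simp only: mult_ac)
      qed
      ultimately show ?thesis by (simp add: a_def algebra_simps)
    qed
    also have "\<dots> \<le> (U x)\<^sup>2 + D - c * n x ^ (2 * k + 1)"
      using D(2)[OF n[of x]] by linarith
    finally show ?thesis .
  qed
  show ?thesis
    unfolding lyapunov_def
  proof (intro conjI)
    show "\<exists>A\<ge>0. \<forall>x. (U x)\<^sup>2 \<le> A * (1 + n x) ^ (2 * k + 1 + 1)"
      using sq_le by (intro exI[of _ "A\<^sup>2"]) auto
    show "\<exists>b\<ge>0. \<forall>x. \<forall>y\<in>set_pmf (K x). \<bar>(U y)\<^sup>2 - (U x)\<^sup>2\<bar> \<le> b * (1 + n x) ^ (2 * k + 1)"
      using incr A b by (intro exI[of _ "b * (2 * A + b)"]) auto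
    show "\<exists>C\<ge>0. \<exists>c>0. \<forall>x. step_mean (\<lambda>x. (U x)\<^sup>2) x \<le> (U x)\<^sup>2 + C - c * n x ^ (2 * k + 1)"
      using drift D(1) c(2) by blast
  qed (use low_sq in auto)
qed

text \<open>
  The conditional variances are of order \<open>n x ^ (2 * k)\<close>. The drift of the square of \<open>U\<close> controls the time
  average of the expectation of \<open>n x ^ (2 * k + 1)\<close>, which is more than enough.
\<close>

lemma martingale_second_moment:
  assumes n: "\<And>x. 0 \<le> n x" and k: "1 \<le> k" and lyap: "lyapunov n k U"
  shows "\<exists>B. \<forall>t. measure_pmf.expectation (path_law x0 t) (\<lambda>p. (martingale U p)\<^sup>2) \<le> B * real t"
proof -
  from lyap obtain b where b: "0 \<le> b" "\<And>x y. y \<in> set_pmf (K x) \<Longrightarrow> \<bar>U y - U x\<bar> \<le> b * (1 + n x) ^ k"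
    unfolding lyapunov_def by metis
  from lyapunov_square[OF n k lyap] obtain C c where c: "0 < c"
      "\<And>x. step_mean (\<lambda>y. (U y)\<^sup>2) x \<le> (U x)\<^sup>2 + C - c * n x ^ (2 * k + 1)" and C: "0 \<le> C"
    unfolding lyapunov_def by metis
  obtain D where D: "0 \<le> D" "\<And>z. 0 \<le> z \<Longrightarrow> b\<^sup>2 * (1 + z) ^ (2 * k) \<le> D + c * z ^ (2 * k + 1)"
    using power_dominates[of "b\<^sup>2" c "2 * k"] c by auto
  define v where "v x = D + c * n x ^ (2 * k + 1)" for x
  have v: "step_mean (\<lambda>y. (U y - U x)\<^sup>2) x \<le> v x" for x
  proof -
    have "step_mean (\<lambda>y. (U y - U x)\<^sup>2) x \<le> step_mean (\<lambda>y. v x) x"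
    proof (rule step_mean_mono)
      fix y assume "y \<in> set_pmf (K x)"
      then have "(U y - U x)\<^sup>2 \<le> (b * (1 + n x) ^ k)\<^sup>2"
        using b by (metis abs_ge_zero power2_abs power_mono)
      also have "\<dots> = b\<^sup>2 * (1 + n x) ^ (2 * k)"
        by (simp add: power_mult_distrib power_mult[symmetric] mult.commute)
      also have "\<dots> \<le> v x" unfolding v_def by (rule D(2)[OF n])
      finally show "(U y - U x)\<^sup>2 \<le> v x" .
    qed
    then show ?thesis by (simp add: measure_pmf.prob_space)
  qed
  have "measure_pmf.expectation (path_law x0 t) (\<lambda>p. (martingale U p)\<^sup>2) \<le> (D + C + (U x0)\<^sup>2) * real t" for t
  proof (cases "t = 0")
    case False
    have "measure_pmf.expectation (path_law x0 t) (\<lambda>p. (martingale U p)\<^sup>2) \<le>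
        (\<Sum>s<t. measure_pmf.expectation (path_law x0 s) (\<lambda>p. v (hd p)))"
      by (rule expectation_martingale_square[OF v])
    also have "\<dots> = D * t + (\<Sum>s<t. measure_pmf.expectation (path_law x0 s) (\<lambda>p. c * n (hd p) ^ (2 * k + 1)))"
      unfolding v_def by (simp add: integrable_path_law measure_pmf.prob_space sum.distrib)
    also have "\<dots> \<le> D * t + (C * t + (U x0)\<^sup>2)"
      using expectation_drift[where U="\<lambda>x. (U x)\<^sup>2" and g="\<lambda>x. c * n x ^ (2 * k + 1)", OF _ c(2)]
      by simp
    also have "\<dots> \<le> (D + C + (U x0)\<^sup>2) * real t"
      using False mult_left_mono[of 1 "real t" "(U x0)\<^sup>2"] by (simp add: algebra_simps)
    finally show ?thesis .
  qed simp
  then show ?thesis by blast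
qed

end

section \<open>Ergodic averages of a chain with a Lyapunov function\<close>

locale finite_step_chain = finite_step_kernel K for K :: "'s::countable \<Rightarrow> 's pmf" +
  fixes M :: "'a measure" and X :: "nat \<Rightarrow> 'a \<Rightarrow> 's" and x0 :: 's
  assumes chain: "markov_chain M X (\<lambda>x y. pmf (K x) y) x0"
begin

sublocale prob_space M using chain by (simp add: markov_chain_def)

lemma X_measurable [measurable]: "X t \<in> measurable M (count_space UNIV)"
  using chain by (simp add: markov_chain_def)

lemma history_measurable [measurable]: "history X t \<in> measurable M (count_space UNIV)"
proof (induction t)
  case 0
  have "(\<lambda>\<omega>. [X 0 \<omega>]) \<in> measurable M (count_space UNIV)" by measurable
  then show ?case by (simp cong: measurable_cong)
next
  case (Suc t)
  note [measurable] = Suc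
  have "(\<lambda>\<omega>. X (Suc t) \<omega> # history X t \<omega>) \<in> measurable M (count_space UNIV)" by measurable
  then show ?case by (simp cong: measurable_cong)
qed

text \<open>
  The Markov property concerns histories of positive probability. A history of probability zero keeps
  probability zero when it is prolonged, in agreement with the product formula.
\<close>

lemma prob_history: "\<P>(\<omega> in M. history X t \<omega> = p) = pmf (path_law x0 t) p"
proof (induction t arbitrary: p)
  case 0
  have ae: "AE \<omega> in M. X 0 \<omega> = x0" using chain by (simp add: markov_chain_def)
  have "\<P>(\<omega> in M. history X 0 \<omega> = p) = \<P>(\<omega> in M. [x0] = p)"
    by (rule prob_eq_AE) (use ae in auto)
  then show ?case by (cases "[x0] = p") (auto simp: prob_space)
next
  case (Suc t)
  consider "p = []" | y q where "p = y # q" by (cases p) auto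
  then show ?case
  proof cases
    case 1
    then show ?thesis by (auto simp: pmf_eq_0_set_pmf)
  next
    case (2 y q)
    have suc: "\<P>(\<omega> in M. history X (Suc t) \<omega> = p) =
        \<P>(\<omega> in M. X (Suc t) \<omega> = y \<and> history X t \<omega> = q)" by (simp add: 2)
    show ?thesis
    proof (cases "\<P>(\<omega> in M. history X t \<omega> = q) = 0")
      case True
      have "\<P>(\<omega> in M. X (Suc t) \<omega> = y \<and> history X t \<omega> = q) \<le> \<P>(\<omega> in M. history X t \<omega> = q)"
        by (intro finite_measure_mono) auto
      with True suc Suc[of q] 2 show ?thesis
        by (simp add: pmf_path_law_Suc del: path_law.simps) (simp add: measure_le_0_iff)
    next
      case False
      then obtain \<omega>0 where "history X t \<omega>0 = q" by (metis (mono_tags, lifting) Collect_empty_eq measure_empty)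
      then have len: "length q = Suc t" by auto
      define z where "z s = (if s \<le> t then q ! (t - s) else y)" for s
      have eq: "(\<forall>s\<le>t. X s \<omega> = z s) \<longleftrightarrow> history X t \<omega> = q" for \<omega>
        using history_eq_iff[OF len, of X \<omega>] by (auto simp: z_def)
      have "\<P>(\<omega> in M. \<forall>s\<le>t. X s \<omega> = z s) > 0"
        unfolding eq using False by (simp add: zero_less_measure_iff)
      with chain have "\<P>(\<omega> in M. X (Suc t) \<omega> = z (Suc t) \<bar> \<forall>s\<le>t. X s \<omega> = z s) =
          pmf (K (z t)) (z (Suc t))"
        unfolding markov_chain_def by blast
      then have "\<P>(\<omega> in M. X (Suc t) \<omega> = y \<and> history X t \<omega> = q) / \<P>(\<omega> in M. history X t \<omega> = q)
          = pmf (K (q ! 0)) y"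
        unfolding eq cond_prob_def by (simp add: z_def)
      moreover have "q ! 0 = hd q" using len by (cases q) auto
      ultimately show ?thesis
        using False Suc[of q] suc 2 by (simp add: pmf_path_law_Suc field_simps del: path_law.simps)
    qed
  qed
qed

lemma distr_history: "distr M (count_space UNIV) (history X t) = measure_pmf (path_law x0 t)"
proof (rule measure_eqI_countable[of _ UNIV])
  fix p :: "'s list"
  have "emeasure (distr M (count_space UNIV) (history X t)) {p} = emeasure M {\<omega>\<in>space M. history X t \<omega> = p}"
    by (subst emeasure_distr) (auto intro!: arg_cong[where f="emeasure M"])
  also have "\<dots> = ennreal (pmf (path_law x0 t) p)"
    by (simp add: emeasure_eq_measure prob_history)
  finally show "emeasure (distr M (count_space UNIV) (history X t)) {p} = emeasure (measure_pmf (path_law x0 t)) {p}"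
    by (simp add: emeasure_pmf_single)
qed auto

lemma nn_integral_history:
  assumes "\<And>p. 0 \<le> F p"
  shows "(\<integral>\<^sup>+\<omega>. ennreal (F (history X t \<omega>)) \<partial>M) = ennreal (measure_pmf.expectation (path_law x0 t) F)"
proof -
  have "(\<integral>\<^sup>+\<omega>. ennreal (F (history X t \<omega>)) \<partial>M) =
      (\<integral>\<^sup>+p. ennreal (F p) \<partial>distr M (count_space UNIV) (history X t))"
    by (subst nn_integral_distr) auto
  also have "\<dots> = ennreal (measure_pmf.expectation (path_law x0 t) F)"
    unfolding distr_history by (rule nn_integral_eq_integral[OF integrable_path_law]) (simp add: assms)
  finally show ?thesis .
qed

text \<open>
  The second moments of the rescaled martingale at the times \<open>m\<^sup>2\<close> are at most of order \<open>1 / m\<^sup>2\<close>. Their sum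
  is finite, so almost surely the squares themselves have a finite sum.
\<close>

lemma martingale_squares_tendsto:
  assumes bound: "\<And>t. measure_pmf.expectation (path_law x0 t) (\<lambda>p. (martingale h p)\<^sup>2) \<le> B * real t"
  shows "AE \<omega> in M. (\<lambda>m. martingale h (history X (m\<^sup>2) \<omega>) / real (m\<^sup>2)) \<longlonglongrightarrow> 0"
proof -
  have sm: "summable (\<lambda>m. \<bar>B\<bar> / (real m)\<^sup>2)"
    using summable_mult[OF inverse_power_summable[of 2, where 'a=real], of "\<bar>B\<bar>"]
    by (simp add: divide_inverse)
  have *: "(\<integral>\<^sup>+\<omega>. ennreal ((martingale h (history X (m\<^sup>2) \<omega>) / real (m\<^sup>2))\<^sup>2) \<partial>M) \<le> ennreal (\<bar>B\<bar> / (real m)\<^sup>2)" for m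
  proof (cases "m = 0")
    case False
    have "(\<integral>\<^sup>+\<omega>. ennreal ((martingale h (history X (m\<^sup>2) \<omega>) / real (m\<^sup>2))\<^sup>2) \<partial>M)
        = ennreal (measure_pmf.expectation (path_law x0 (m\<^sup>2)) (\<lambda>p. (martingale h p)\<^sup>2) / (real (m\<^sup>2))\<^sup>2)"
      by (subst nn_integral_history) (auto simp: power_divide)
    also have "\<dots> \<le> ennreal (B * real (m\<^sup>2) / (real (m\<^sup>2))\<^sup>2)"
      by (intro ennreal_leI divide_right_mono bound) auto
    also have "\<dots> \<le> ennreal (\<bar>B\<bar> / (real m)\<^sup>2)"
      using False by (intro ennreal_leI) (auto simp: power2_eq_square field_simps)
    finally show ?thesis .
  qed (simp)
  have "(\<integral>\<^sup>+\<omega>. (\<Sum>m. ennreal ((martingale h (history X (m\<^sup>2) \<omega>) / real (m\<^sup>2))\<^sup>2)) \<partial>M)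
      = (\<Sum>m. \<integral>\<^sup>+\<omega>. ennreal ((martingale h (history X (m\<^sup>2) \<omega>) / real (m\<^sup>2))\<^sup>2) \<partial>M)"
    by (rule nn_integral_suminf) auto
  also have "\<dots> \<le> (\<Sum>m. ennreal (\<bar>B\<bar> / (real m)\<^sup>2))"
    by (intro suminf_le * summableI)
  also have "\<dots> < \<infinity>"
    using sm by (subst suminf_ennreal2) auto
  finally have "AE \<omega> in M. (\<Sum>m. ennreal ((martingale h (history X (m\<^sup>2) \<omega>) / real (m\<^sup>2))\<^sup>2)) \<noteq> \<infinity>"
    by (intro nn_integral_noteq_infinite) auto
  then show ?thesis
  proof eventually_elim
    case (elim \<omega>)
    then have "summable (\<lambda>m. (martingale h (history X (m\<^sup>2) \<omega>) / real (m\<^sup>2))\<^sup>2)"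
      by (intro summable_suminf_not_top) auto
    from tendsto_real_sqrt[OF summable_LIMSEQ_zero[OF this]]
    have "(\<lambda>m. \<bar>martingale h (history X (m\<^sup>2) \<omega>) / real (m\<^sup>2)\<bar>) \<longlonglongrightarrow> 0" by simp
    then show ?case
      by (rule tendsto_rabs_zero_cancel)
  qed
qed

lemma state_space_iff: "x \<in> state_space M X \<longleftrightarrow> (\<exists>t. x \<in> hd ` set_pmf (path_law x0 t))"
proof -
  have "\<P>(\<omega> in M. X t \<omega> = x) = measure (measure_pmf (path_law x0 t)) {p. hd p = x}" for t
  proof -
    have "measure (distr M (count_space UNIV) (history X t)) {p. hd p = x} = \<P>(\<omega> in M. X t \<omega> = x)"
      by (subst measure_distr) (auto intro!: arg_cong[where f=prob])
    then show ?thesis unfolding distr_history by simp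
  qed
  moreover have "measure (measure_pmf (path_law x0 t)) {p. hd p = x} > 0 \<longleftrightarrow> x \<in> hd ` set_pmf (path_law x0 t)" for t
    by (subst zero_less_measure_iff) (auto simp: measure_pmf_zero_iff)
  ultimately show ?thesis unfolding state_space_def by auto
qed

lemma state_space_closed:
  assumes "x \<in> state_space M X" "y \<in> set_pmf (K x)"
  shows "y \<in> state_space M X"
proof -
  from assms(1) obtain t p where p: "p \<in> set_pmf (path_law x0 t)" "x = hd p"
    by (auto simp: state_space_iff)
  then have "y # p \<in> set_pmf (path_law x0 (Suc t))" using assms(2) by auto
  then show ?thesis unfolding state_space_iff by (intro exI[of _ "Suc t"] image_eqI[of _ _ "y # p"]) auto
qed

lemma AE_state_space: "AE \<omega> in M. \<forall>t. X t \<omega> \<in> state_space M X"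
proof (subst AE_all_countable, rule allI)
  fix t
  have "AE p in distr M (count_space UNIV) (history X t). hd p \<in> state_space M X"
    unfolding distr_history by (auto simp: AE_measure_pmf_iff state_space_iff)
  then show "AE \<omega> in M. X t \<omega> \<in> state_space M X"
    by (subst (asm) AE_distr_iff) auto
qed

text \<open>
  The sum over the state space has only finitely many nonzero terms and equals the mass of \<open>y\<close> after one step.
  Outside the state space both sides of the balance equation vanish, because the state space is closed under
  possible steps.
\<close>

lemma invariant_distribution_iff:
  assumes fin: "\<And>y. finite {x. y \<in> set_pmf (K x)}" and supp: "set_pmf p \<subseteq> state_space M X"
  shows "invariant_distribution (state_space M X) (\<lambda>x y. pmf (K x) y) p \<longleftrightarrow> bind_pmf p K = p"
proof -
  let ?S = "state_space M X"
  have fin': "finite ({x. y \<in> set_pmf (K x)} \<inter> ?S)" for y using fin by simp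
  have bind: "pmf (bind_pmf p K) y = (\<Sum>x\<in>{x. y \<in> set_pmf (K x)} \<inter> ?S. pmf p x * pmf (K x) y)" for y
    unfolding pmf_bind
    by (subst integral_measure_pmf[of "{x. y \<in> set_pmf (K x)} \<inter> ?S"])
       (use fin'[of y] supp in \<open>auto simp: set_pmf_iff\<close>)
  have "((\<lambda>x. pmf p x * pmf (K x) y) has_sum pmf (bind_pmf p K) y) ?S" for y
    unfolding bind
    by (subst has_sum_cong_neutral[where T="{x. y \<in> set_pmf (K x)} \<inter> ?S" and g="\<lambda>x. pmf p x * pmf (K x) y"])
       (auto simp: set_pmf_iff intro!: has_sum_finite[OF fin'[unfolded set_pmf_iff]])
  then have *: "((\<lambda>x. pmf p x * pmf (K x) y) has_sum z) ?S \<longleftrightarrow> z = pmf (bind_pmf p K) y" for y z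
    using has_sum_unique by blast
  have out: "pmf (bind_pmf p K) y = pmf p y" if "y \<notin> ?S" for y
  proof -
    have "y \<notin> set_pmf (bind_pmf p K)" using that supp state_space_closed by auto
    moreover have "y \<notin> set_pmf p" using that supp by auto
    ultimately show ?thesis by (metis pmf_eq_0_set_pmf)
  qed
  show ?thesis
    unfolding invariant_distribution_def * using supp out by (metis pmf_eqI)
qed

text \<open>
  The Dynkin martingale of the indicator of \<open>y\<close> compares the empirical frequency of \<open>y\<close> with the frequency
  predicted from the visited states, so its vanishing makes the empirical measures asymptotically invariant.
\<close>

lemma balance_along_squares:
  "AE \<omega> in M. \<forall>y. (\<lambda>m. (\<Sum>s<m\<^sup>2. pmf (K (X s \<omega>)) y - indicator {y} (X s \<omega>)) / real (m\<^sup>2)) \<longlonglongrightarrow> 0"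
proof (subst AE_all_countable, rule allI)
  fix y
  let ?h = "indicator {y} :: 's \<Rightarrow> real"
  have "measure_pmf.expectation (path_law x0 t) (\<lambda>p. (martingale ?h p)\<^sup>2) \<le> 1 * real t" for t
  proof -
    have "step_mean (\<lambda>z. (?h z - ?h x)\<^sup>2) x \<le> step_mean (\<lambda>_. 1) x" for x
      by (rule step_mean_mono) (auto simp: indicator_def)
    then have "step_mean (\<lambda>z. (?h z - ?h x)\<^sup>2) x \<le> 1" for x by (simp add: measure_pmf.prob_space)
    from expectation_martingale_square[OF this, of x0 t] show ?thesis by (simp add: measure_pmf.prob_space)
  qed
  from martingale_squares_tendsto[OF this]
  show "AE \<omega> in M. (\<lambda>m. (\<Sum>s<m\<^sup>2. pmf (K (X s \<omega>)) y - ?h (X s \<omega>)) / real (m\<^sup>2)) \<longlonglongrightarrow> 0"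
  proof eventually_elim
    case (elim \<omega>)
    have "step_mean ?h x = pmf (K x) y" for x by (simp add: pmf.rep_eq)
    then have eq: "(\<Sum>s<m\<^sup>2. pmf (K (X s \<omega>)) y - ?h (X s \<omega>)) / real (m\<^sup>2) =
        (?h (X (m\<^sup>2) \<omega>) - ?h (X 0 \<omega>)) / real (m\<^sup>2) - martingale ?h (history X (m\<^sup>2) \<omega>) / real (m\<^sup>2)" for m
      by (simp add: martingale_history diff_divide_distrib)
    have sq: "filterlim (\<lambda>m::nat. real (m\<^sup>2)) at_top sequentially" by real_asymp
    have "(\<lambda>m. (?h (X (m\<^sup>2) \<omega>) - ?h (X 0 \<omega>)) / real (m\<^sup>2)) \<longlonglongrightarrow> 0"
    proof (rule Lim_null_comparison)
      show "\<forall>\<^sub>F m in sequentially. norm ((?h (X (m\<^sup>2) \<omega>) - ?h (X 0 \<omega>)) / real (m\<^sup>2)) \<le> 1 / real (m\<^sup>2)"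
        by (auto simp: indicator_def intro!: always_eventually)
      show "(\<lambda>m. 1 / real (m\<^sup>2)) \<longlonglongrightarrow> 0"
        by (rule tendsto_divide_0[OF tendsto_const filterlim_at_top_imp_at_infinity[OF sq]])
    qed
    from tendsto_diff[OF this elim] show ?case unfolding eq by simp
  qed
qed

text \<open>
  Along the trajectory, \<open>c * n ^ k\<close> accumulates at most linearly: the drift of \<open>U\<close> pays for it, up to the
  martingale, and \<open>U\<close> cannot become negative.
\<close>

lemma bounded_averages_along_squares:
  assumes n: "\<And>x. 0 \<le> n x" and k: "1 \<le> k" and lyap: "lyapunov n k U"
  shows "AE \<omega> in M. \<exists>B\<ge>0. \<forall>m. (\<Sum>s<m\<^sup>2. n (X s \<omega>) ^ k) / real (m\<^sup>2) \<le> B"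
proof -
  from lyap obtain C c where c: "0 < c" "\<And>x. step_mean U x \<le> U x + C - c * n x ^ k" and C: "0 \<le> C"
    and U: "\<And>x. 0 \<le> U x"
    unfolding lyapunov_def by metis
  obtain B where "\<And>t. measure_pmf.expectation (path_law x0 t) (\<lambda>p. (martingale U p)\<^sup>2) \<le> B * real t"
    using martingale_second_moment[OF n k lyap] by blast
  from martingale_squares_tendsto[OF this] show ?thesis
  proof eventually_elim
    case (elim \<omega>)
    then have "Bseq (\<lambda>m. martingale U (history X (m\<^sup>2) \<omega>) / real (m\<^sup>2))"
      by (intro convergent_imp_Bseq) (auto simp: convergent_def)
    then obtain D where D: "0 < D" "\<And>m. \<bar>martingale U (history X (m\<^sup>2) \<omega>) / real (m\<^sup>2)\<bar> \<le> D"
      by (auto simp: Bseq_def)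
    have "(\<Sum>s<m\<^sup>2. n (X s \<omega>) ^ k) / real (m\<^sup>2) \<le> (C + U (X 0 \<omega>) + D) / c" for m
    proof (cases "m = 0")
      case False
      let ?t = "m\<^sup>2"
      have t: "1 \<le> real ?t" using False by simp
      have "(\<Sum>s<?t. step_mean U (X s \<omega>) - U (X s \<omega>)) \<le> (\<Sum>s<?t. C - c * n (X s \<omega>) ^ k)"
        using c(2) by (intro sum_mono) (simp add: algebra_simps)
      also have "\<dots> = C * ?t - c * (\<Sum>s<?t. n (X s \<omega>) ^ k)"
        by (simp add: sum_subtractf sum_distrib_left)
      finally have "c * (\<Sum>s<?t. n (X s \<omega>) ^ k) \<le> C * ?t - (\<Sum>s<?t. step_mean U (X s \<omega>) - U (X s \<omega>))" by simp
      also have "\<dots> \<le> C * ?t + U (X 0 \<omega>) + martingale U (history X ?t \<omega>)"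
        using U[of "X ?t \<omega>"] by (simp add: martingale_history)
      also have "\<dots> \<le> C * ?t + U (X 0 \<omega>) * ?t + D * ?t"
      proof -
        have "martingale U (history X ?t \<omega>) / ?t \<le> D" using D(2)[of m] by linarith
        then have "martingale U (history X ?t \<omega>) \<le> D * ?t" using False by (simp add: pos_divide_le_eq)
        moreover have "U (X 0 \<omega>) \<le> U (X 0 \<omega>) * ?t" using t U mult_left_mono[of 1 "real ?t" "U (X 0 \<omega>)"] by simp
        ultimately show ?thesis by linarith
      qed
      also have "\<dots> = (C + U (X 0 \<omega>) + D) * ?t" by (simp add: algebra_simps)
      finally have "(\<Sum>s<?t. n (X s \<omega>) ^ k) \<le> (C + U (X 0 \<omega>) + D) * ?t / c"
        using c(1) by (simp only: pos_le_divide_eq mult.commute)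
      moreover have "0 < real ?t" using t by linarith
      ultimately show ?thesis by (simp only: pos_divide_le_eq times_divide_eq_left)
    qed (use C U D(1) c(1) in simp)
    then show ?case using C U[of "X 0 \<omega>"] D(1) c(1) by (intro exI[of _ "(C + U (X 0 \<omega>) + D) / c"]) auto
  qed
qed

text \<open>
  An ergodic theorem for the unbounded function \<open>n\<close>. The square of a Lyapunov function of order 1 has order 3,
  and the resulting bound on the third moments of the empirical measures makes \<open>n\<close> uniformly integrable under
  them. All their limit points are invariant, hence equal.
\<close>

theorem ergodic_averages:
  assumes fin_pred: "\<And>y. finite {x. y \<in> set_pmf (K x)}"
    and n: "\<And>x. 0 \<le> n x" and fin: "\<And>R. finite {x. n x \<le> R}"
    and lyap: "lyapunov n 1 V"
    and reach: "\<And>x. (x, x0) \<in> {(x, y). y \<in> set_pmf (K x)}\<^sup>*"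
  shows "\<exists>\<pi>. invariant_distribution (state_space M X) (\<lambda>x y. pmf (K x) y) \<pi> \<and>
    (\<forall>\<pi>'. invariant_distribution (state_space M X) (\<lambda>x y. pmf (K x) y) \<pi>' \<longrightarrow> \<pi>' = \<pi>) \<and>
    integrable (measure_pmf \<pi>) n \<and>
    (AE \<omega> in M. (\<lambda>t. (1 / real t) * (\<Sum>s = 1..t. n (X s \<omega>))) \<longlonglongrightarrow> measure_pmf.expectation \<pi> n)"
proof -
  define good where "good \<omega> \<longleftrightarrow>
      (\<forall>t. X t \<omega> \<in> state_space M X) \<and>
      (\<exists>B\<ge>0. \<forall>m. (\<Sum>s<m\<^sup>2. n (X s \<omega>) ^ 3) / real (m\<^sup>2) \<le> B) \<and>
      (\<forall>y. (\<lambda>m. (\<Sum>s<m\<^sup>2. pmf (K (X s \<omega>)) y - indicator {y} (X s \<omega>)) / real (m\<^sup>2)) \<longlonglongrightarrow> 0)" for \<omega>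
  have lyap3: "lyapunov n 3 (\<lambda>x. (V x)\<^sup>2)"
    using lyapunov_square[OF n _ lyap] by simp
  have good: "AE \<omega> in M. good \<omega>"
    using AE_state_space bounded_averages_along_squares[OF n _ lyap3] balance_along_squares
    unfolding good_def by (auto elim: eventually_elim2)
  \<comment> \<open>the empirical measure up to time \<open>(m + 1)\<^sup>2\<close>; the shift avoids an average over no times\<close>
  define \<mu> where "\<mu> \<omega> m = map_pmf (\<lambda>s. X s \<omega>) (pmf_of_set {..<(Suc m)\<^sup>2})" for \<omega> m
  have exp_\<mu>: "measure_pmf.expectation (\<mu> \<omega> m) f = (\<Sum>s<(Suc m)\<^sup>2. f (X s \<omega>)) / real ((Suc m)\<^sup>2)"
    for \<omega> m and f :: "'s \<Rightarrow> real"
    unfolding \<mu>_def by (subst integral_map_pmf, subst integral_pmf_of_set) (auto simp: lessThan_empty_iff)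
  have set_\<mu>: "set_pmf (\<mu> \<omega> m) = (\<lambda>s. X s \<omega>) ` {..<(Suc m)\<^sup>2}" for \<omega> m
    unfolding \<mu>_def by (simp add: set_pmf_of_set lessThan_empty_iff)
  have subsequence: "\<exists>r' \<pi>. strict_mono r' \<and> set_pmf \<pi> \<subseteq> state_space M X \<and> bind_pmf \<pi> K = \<pi> \<and>
      integrable (measure_pmf \<pi>) n \<and>
      (\<lambda>k. measure_pmf.expectation (\<mu> \<omega> (r (r' k))) n) \<longlonglongrightarrow> measure_pmf.expectation \<pi> n"
    if "good \<omega>" and r: "strict_mono r" for \<omega> and r :: "nat \<Rightarrow> nat"
  proof -
    from \<open>good \<omega>\<close> obtain B where S: "\<And>t. X t \<omega> \<in> state_space M X"
      and B: "\<And>m. (\<Sum>s<m\<^sup>2. n (X s \<omega>) ^ 3) / real (m\<^sup>2) \<le> B"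
      and bal: "\<And>y. (\<lambda>m. (\<Sum>s<m\<^sup>2. pmf (K (X s \<omega>)) y - indicator {y} (X s \<omega>)) / real (m\<^sup>2)) \<longlonglongrightarrow> 0"
      unfolding good_def by auto
    have "integrable (measure_pmf (\<mu> \<omega> m)) (f :: 's \<Rightarrow> real)" for m f
      by (rule integrable_measure_pmf_finite) (simp add: set_\<mu>)
    moreover have "measure_pmf.expectation (\<mu> \<omega> m) (\<lambda>x. n x ^ 3) \<le> B" for m
      unfolding exp_\<mu> by (rule B)
    ultimately obtain r' \<pi> where r': "strict_mono r'"
      and lim: "\<And>y. (\<lambda>k. pmf (\<mu> \<omega> (r (r' k))) y) \<longlonglongrightarrow> pmf \<pi> y"
      and int: "integrable (measure_pmf \<pi>) n"
      and exp: "(\<lambda>k. measure_pmf.expectation (\<mu> \<omega> (r (r' k))) n) \<longlonglongrightarrow> measure_pmf.expectation \<pi> n"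
      using convergent_subsequence_pmf[OF fin n, of 3 "\<lambda>m. \<mu> \<omega> (r m)" B] by auto
    have supp: "set_pmf \<pi> \<subseteq> state_space M X"
    proof
      fix y assume "y \<in> set_pmf \<pi>"
      show "y \<in> state_space M X"
      proof (rule ccontr)
        assume "y \<notin> state_space M X"
        then have "pmf (\<mu> \<omega> m) y = 0" for m using S by (auto simp: pmf_eq_0_set_pmf set_\<mu>)
        then have "pmf \<pi> y = 0" using lim[of y] by (simp add: LIMSEQ_const_iff)
        with \<open>y \<in> set_pmf \<pi>\<close> show False by (simp add: set_pmf_iff)
      qed
    qed
    have "bind_pmf \<pi> K = \<pi>"
    proof (rule pmf_eqI)
      fix y
      have bind: "measure_pmf.expectation p (\<lambda>x. pmf (K x) y) =
          (\<Sum>x | y \<in> set_pmf (K x). pmf p x * pmf (K x) y)" for p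
        by (subst integral_measure_pmf[OF fin_pred[of y]]) (auto simp: set_pmf_iff)
      have "(\<lambda>k. measure_pmf.expectation (\<mu> \<omega> (r (r' k))) (\<lambda>x. pmf (K x) y)) \<longlonglongrightarrow>
          measure_pmf.expectation \<pi> (\<lambda>x. pmf (K x) y)"
        unfolding bind by (intro tendsto_intros lim)
      from tendsto_diff[OF this lim[of y]]
      have 1: "(\<lambda>k. measure_pmf.expectation (\<mu> \<omega> (r (r' k))) (\<lambda>x. pmf (K x) y) - pmf (\<mu> \<omega> (r (r' k))) y)
          \<longlonglongrightarrow> pmf (bind_pmf \<pi> K) y - pmf \<pi> y" by (simp add: pmf_bind)
      have eq: "measure_pmf.expectation (\<mu> \<omega> m) (\<lambda>x. pmf (K x) y) - pmf (\<mu> \<omega> m) y =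
         (\<Sum>s<(Suc m)\<^sup>2. pmf (K (X s \<omega>)) y - indicator {y} (X s \<omega>)) / real ((Suc m)\<^sup>2)" for m
      proof -
        have "pmf (\<mu> \<omega> m) y = measure_pmf.expectation (\<mu> \<omega> m) (indicator {y})" by (simp add: pmf.rep_eq)
        then show ?thesis by (simp only: exp_\<mu> sum_subtractf diff_divide_distrib)
      qed
      have "(\<lambda>k. measure_pmf.expectation (\<mu> \<omega> (r (r' k))) (\<lambda>x. pmf (K x) y) - pmf (\<mu> \<omega> (r (r' k))) y)
          \<longlonglongrightarrow> 0"
        using LIMSEQ_subseq_LIMSEQ[OF LIMSEQ_subseq_LIMSEQ[OF LIMSEQ_Suc[OF bal[of y]] r] r']
        unfolding eq by (simp add: o_def)
      from LIMSEQ_unique[OF 1 this] show "pmf (bind_pmf \<pi> K) y = pmf \<pi> y" by simp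
    qed
    with r' supp int exp show ?thesis by blast
  qed
  have "\<exists>\<omega>. good \<omega>"
    using eventually_happens[OF good] by (simp add: ae_filter_eq_bot_iff emeasure_space_1)
  then obtain \<omega>0 where "good \<omega>0" by blast
  from subsequence[OF this strict_mono_id] obtain \<pi> where supp: "set_pmf \<pi> \<subseteq> state_space M X"
    and inv: "bind_pmf \<pi> K = \<pi>" and int: "integrable (measure_pmf \<pi>) n" by blast
  have lim: "(\<lambda>t. (1 / real t) * (\<Sum>s = 1..t. n (X s \<omega>))) \<longlonglongrightarrow> measure_pmf.expectation \<pi> n"
    if "good \<omega>" for \<omega>
  proof (rule averages_tendsto_if_squares[OF n])
    have "(\<lambda>m. measure_pmf.expectation (\<mu> \<omega> m) n) \<longlonglongrightarrow> measure_pmf.expectation \<pi> n"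
    proof (rule tendsto_if_subsequences_tendsto)
      fix r :: "nat \<Rightarrow> nat" assume "strict_mono r"
      from subsequence[OF \<open>good \<omega>\<close> this] obtain r' \<pi>' where "strict_mono r'" "bind_pmf \<pi>' K = \<pi>'"
        "(\<lambda>k. measure_pmf.expectation (\<mu> \<omega> (r (r' k))) n) \<longlonglongrightarrow> measure_pmf.expectation \<pi>' n" by blast
      then show "\<exists>r'. strict_mono r' \<and>
          (\<lambda>k. measure_pmf.expectation (\<mu> \<omega> (r (r' k))) n) \<longlonglongrightarrow> measure_pmf.expectation \<pi> n"
        using invariant_pmf_unique[OF _ inv reach] by blast
    qed
    then show "(\<lambda>m. (\<Sum>s<m\<^sup>2. n (X s \<omega>)) / real (m\<^sup>2)) \<longlonglongrightarrow> measure_pmf.expectation \<pi> n"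
      unfolding exp_\<mu> by (rule LIMSEQ_imp_Suc)
  qed
  show ?thesis
  proof (intro exI[of _ \<pi>] conjI allI impI)
    show "invariant_distribution (state_space M X) (\<lambda>x y. pmf (K x) y) \<pi>"
      using invariant_distribution_iff[OF fin_pred supp] inv by blast
    show "\<pi>' = \<pi>" if "invariant_distribution (state_space M X) (\<lambda>x y. pmf (K x) y) \<pi>'" for \<pi>'
      using invariant_distribution_iff[OF fin_pred, of \<pi>'] that invariant_pmf_unique[OF _ inv reach]
      by (auto simp: invariant_distribution_def)
    show "integrable (measure_pmf \<pi>) n" by (rule int)
    show "AE \<omega> in M. (\<lambda>t. (1 / real t) * (\<Sum>s = 1..t. n (X s \<omega>))) \<longlonglongrightarrow> measure_pmf.expectation \<pi> n"
      using good by eventually_elim (rule lim)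
  qed
qed

end

section \<open>The matching policy and its energy drift\<close>

lemma sup_norm_ge: "real (x i) \<le> sup_norm x"
  unfolding sup_norm_def by (rule Max_ge) auto

lemma sup_norm_attained: "\<exists>i. sup_norm x = real (x i)"
proof -
  have "sup_norm x \<in> range (\<lambda>i. \<bar>real (x i)\<bar>)"
    unfolding sup_norm_def by (rule Max_in) auto
  then show ?thesis by auto
qed

lemma sup_norm_nonneg: "0 \<le> sup_norm x"
  using sup_norm_attained[of x] by auto

lemma finite_sup_norm_le: "finite {x. sup_norm x \<le> R}"
proof (rule finite_subset)
  show "{x. sup_norm x \<le> R} \<subseteq> (UNIV :: 'c::finite set) \<rightarrow>\<^sub>E {..nat \<lfloor>R\<rfloor>}"
  proof
    fix x :: "'c \<Rightarrow> nat" assume "x \<in> {x. sup_norm x \<le> R}"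
    then have "real (x i) \<le> R" for i using sup_norm_ge[of x i] by simp
    then have "x i \<le> nat \<lfloor>R\<rfloor>" for i by (simp add: le_nat_floor)
    then show "x \<in> UNIV \<rightarrow>\<^sub>E {..nat \<lfloor>R\<rfloor>}" by (simp add: PiE_UNIV_domain)
  qed
  show "finite ((UNIV :: 'c::finite set) \<rightarrow>\<^sub>E {..nat \<lfloor>R\<rfloor>})" by (rule finite_PiE) auto
qed

lemma layer_cake:
  fixes a :: "'i \<Rightarrow> real" and y :: "'i \<Rightarrow> nat"
  assumes "finite J" and "\<And>i. i \<in> J \<Longrightarrow> y i \<le> B"
  shows "(\<Sum>i\<in>J. a i * real (y i)) = (\<Sum>s<B. \<Sum>i | i \<in> J \<and> s < y i. a i)"
proof -
  have "real (y i) = (\<Sum>s<B. if s < y i then 1 else 0)" if "i \<in> J" for i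
  proof -
    have "{..<B} \<inter> {s. s < y i} = {..<y i}" using assms(2)[OF that] by auto
    then show ?thesis by (simp add: sum.If_cases)
  qed
  then have "(\<Sum>i\<in>J. a i * real (y i)) = (\<Sum>i\<in>J. \<Sum>s<B. if s < y i then a i else 0)"
    by (intro sum.cong) (auto simp: sum_distrib_left intro!: sum.cong)
  also have "\<dots> = (\<Sum>s<B. \<Sum>i\<in>J. if s < y i then a i else 0)" by (rule sum.swap)
  also have "\<dots> = (\<Sum>s<B. \<Sum>i | i \<in> J \<and> s < y i. a i)"
    by (intro sum.cong refl sum.inter_filter[OF assms(1), symmetric])
  finally show ?thesis .
qed

lemma ex_lower_bound_positive:
  fixes \<rho> :: "'c::finite \<Rightarrow> 'c \<Rightarrow> real"
  shows "\<exists>r. 0 < r \<and> r \<le> 1 \<and> (\<forall>i j. 0 < \<rho> i j \<longrightarrow> r \<le> \<rho> i j)"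
proof -
  let ?R = "insert 1 {u \<in> range (\<lambda>(i, j). \<rho> i j). 0 < u}"
  have fin: "finite ?R" by simp
  have "Min ?R \<in> ?R" by (rule Min_in[OF fin]) simp
  then have "0 < Min ?R" by auto
  moreover have "Min ?R \<le> \<rho> i j" if "0 < \<rho> i j" for i j
    by (rule Min_le[OF fin]) (use that in \<open>auto intro!: rev_image_eqI[of "(i, j)"]\<close>)
  moreover have "Min ?R \<le> 1" by (rule Min_le[OF fin]) simp
  ultimately show ?thesis by blast
qed

text \<open>
  There are finitely many independent sets, so the strict inequalities of NCOND hold with a common factor.
\<close>

lemma NCOND_uniform:
  fixes \<nu> :: "'c::finite pmf"
  assumes "NCOND \<rho> \<nu>"
  shows "\<exists>\<delta>. 0 < \<delta> \<and> \<delta> \<le> 1 \<and> (\<forall>I. root_independent \<rho> I \<longrightarrow>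
    measure_pmf.prob \<nu> I \<le> (1 - \<delta>) * measure_pmf.prob \<nu> (root_neighbours \<rho> I))"
proof -
  let ?r = "\<lambda>I. measure_pmf.prob \<nu> I / measure_pmf.prob \<nu> (root_neighbours \<rho> I)"
  let ?R = "insert 0 (?r ` {I. I \<noteq> {} \<and> root_independent \<rho> I})"
  have fin: "finite ?R" by simp
  have pos: "measure_pmf.prob \<nu> I < measure_pmf.prob \<nu> (root_neighbours \<rho> I)"
    if "I \<noteq> {}" "root_independent \<rho> I" for I
    using assms that unfolding NCOND_def by blast
  have nbr: "0 < measure_pmf.prob \<nu> (root_neighbours \<rho> I)" if "I \<noteq> {}" "root_independent \<rho> I" for I
    using pos[OF that] by (rule le_less_trans[rotated]) simp
  have "?r I < 1" if "I \<noteq> {}" "root_independent \<rho> I" for I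
    using pos[OF that] nbr[OF that] by (simp add: pos_divide_less_eq)
  then have "u < 1" if u: "u \<in> ?R" for u using u by auto
  moreover have "Max ?R \<in> ?R" by (rule Max_in[OF fin]) simp
  ultimately have lt: "Max ?R < 1" by blast
  have ge: "0 \<le> Max ?R" by (rule Max_ge[OF fin]) simp
  have "measure_pmf.prob \<nu> I \<le> (1 - (1 - Max ?R)) * measure_pmf.prob \<nu> (root_neighbours \<rho> I)"
    if I: "root_independent \<rho> I" for I
  proof (cases "I = {}")
    case False
    have "?r I \<le> Max ?R" by (rule Max_ge[OF fin]) (use False I in auto)
    then show ?thesis using nbr[OF False I] by (simp add: pos_divide_le_eq)
  qed (simp add: root_neighbours_def)
  with lt ge show ?thesis by (intro exI[of _ "1 - Max ?R"]) auto
qed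

text \<open>
  The lexicographic maximiser exists on a finite set of classes and is unique because \<open>\<alpha>\<close> breaks all ties.
\<close>

lemma policy_maximal:
  fixes \<alpha> :: "'c::finite \<Rightarrow> nat"
  assumes inj: "inj \<alpha>"
  shows "w (x k) (\<rho> i k) \<le> w (x (policy \<rho> w \<alpha> x i)) (\<rho> i (policy \<rho> w \<alpha> x i))"
proof -
  let ?s = "\<lambda>k. (w (x k) (\<rho> i k), \<alpha> k)"
  let ?lt = "{(a :: real, b). a < b} <*lex*> {(a :: nat, b). a < b}"
  have mem: "(?s k, ?s j) \<in> ?lt\<^sup>= \<longleftrightarrow>
      w (x k) (\<rho> i k) < w (x j) (\<rho> i j) \<or> (w (x k) (\<rho> i k) = w (x j) (\<rho> i j) \<and> \<alpha> k \<le> \<alpha> j)" for j k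
    by auto
  define W where "W = (MAX k. w (x k) (\<rho> i k))"
  define J where "J = {j. w (x j) (\<rho> i j) = W}"
  have "W \<in> range (\<lambda>k. w (x k) (\<rho> i k))" unfolding W_def by (rule Max_in) auto
  then have "J \<noteq> {}" unfolding J_def by auto
  then have "Max (\<alpha> ` J) \<in> \<alpha> ` J" by (intro Max_in) auto
  then obtain j where j: "j \<in> J" "\<And>k. k \<in> J \<Longrightarrow> \<alpha> k \<le> \<alpha> j"
    by (metis (mono_tags, lifting) Max_ge finite finite_imageI image_iff imageI)
  have le: "w (x k) (\<rho> i k) \<le> W" for k unfolding W_def by (rule Max_ge) auto
  have ex: "\<forall>k. (?s k, ?s j) \<in> ?lt\<^sup>="
    unfolding mem using j le by (auto simp: J_def order.strict_iff_order)
  have "j' = j" if "\<forall>k. (?s k, ?s j') \<in> ?lt\<^sup>=" for j'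
  proof -
    have "\<alpha> j' = \<alpha> j" using that[rule_format, of j] ex[rule_format, of j'] unfolding mem by auto
    then show ?thesis using inj by (simp add: inj_eq)
  qed
  then have "policy \<rho> w \<alpha> x i = j"
    unfolding policy_def using ex by (intro the_equality) blast+
  then show ?thesis using j(1) le by (simp add: J_def)
qed

locale matching =
  fixes \<nu> :: "'c::finite pmf" and \<rho> :: "'c \<Rightarrow> 'c \<Rightarrow> real"
    and w :: "nat \<Rightarrow> real \<Rightarrow> real" and \<alpha> :: "'c \<Rightarrow> nat"
  assumes \<nu>_pos: "\<And>i. 0 < pmf \<nu> i"
    and \<rho>_unit: "\<And>i j. \<rho> i j \<in> {0..1}" and \<rho>_sym: "\<And>i j. \<rho> i j = \<rho> j i"
    and weight: "weight_function w" and \<alpha>_inj: "inj \<alpha>" and ncond: "NCOND \<rho> \<nu>"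
begin

abbreviation \<phi> :: "('c \<Rightarrow> nat) \<Rightarrow> 'c \<Rightarrow> 'c" where
  "\<phi> \<equiv> policy \<rho> w \<alpha>"

text \<open>
  The probability that an arrival of class \<open>i\<close> is incompatible with every item of the queue it inspects.
\<close>

definition miss :: "('c \<Rightarrow> nat) \<Rightarrow> 'c \<Rightarrow> real" where
  "miss x i = (1 - \<rho> i (\<phi> x i)) ^ x (\<phi> x i)"

lemma miss_unit: "0 \<le> miss x i" "miss x i \<le> 1"
  unfolding miss_def using \<rho>_unit[of i "\<phi> x i"] by (auto intro: power_le_one)

text \<open>
  A class is drawn from \<open>\<nu>\<close>, then a coin decides between joining the own queue and removing a match. If the
  inspected queue is empty then the coin always shows \<open>True\<close>, so the truncated subtraction has no effect.
\<close>

definition kernel :: "('c \<Rightarrow> nat) \<Rightarrow> ('c \<Rightarrow> nat) pmf" where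
  "kernel x = \<nu> \<bind> (\<lambda>i. map_pmf
     (\<lambda>b. if b then x(i := x i + 1) else x(\<phi> x i := x (\<phi> x i) - 1)) (bernoulli_pmf (miss x i)))"

sublocale finite_step_kernel kernel
proof
  show "finite (set_pmf (kernel x))" for x unfolding kernel_def by simp
qed

lemma step_mean_kernel:
  "step_mean h x = (\<Sum>i\<in>UNIV. pmf \<nu> i *
     (miss x i * h (x(i := x i + 1)) + (1 - miss x i) * h (x(\<phi> x i := x (\<phi> x i) - 1))))"
proof -
  let ?f = "\<lambda>i b. if b then x(i := x i + 1) else x(\<phi> x i := x (\<phi> x i) - 1)"
  have "step_mean h x = (\<Sum>i\<in>UNIV. pmf \<nu> i *\<^sub>R
      measure_pmf.expectation (map_pmf (?f i) (bernoulli_pmf (miss x i))) h)"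
    unfolding kernel_def by (rule pmf_expectation_bind) simp_all
  also have "\<dots> = (\<Sum>i\<in>UNIV. pmf \<nu> i *
     (miss x i * h (x(i := x i + 1)) + (1 - miss x i) * h (x(\<phi> x i := x (\<phi> x i) - 1))))"
  proof (rule sum.cong[OF refl])
    fix i
    have "measure_pmf.expectation (map_pmf (?f i) (bernoulli_pmf (miss x i))) h =
        h (?f i True) * miss x i + h (?f i False) * (1 - miss x i)"
      by (subst integral_map_pmf, rule integral_bernoulli_pmf) (rule miss_unit)+
    then show "pmf \<nu> i *\<^sub>R measure_pmf.expectation (map_pmf (?f i) (bernoulli_pmf (miss x i))) h =
        pmf \<nu> i * (miss x i * h (x(i := x i + 1)) + (1 - miss x i) * h (x(\<phi> x i := x (\<phi> x i) - 1)))"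
      by (simp only: if_True if_False real_scaleR_def mult.commute)
  qed
  finally show ?thesis .
qed

lemma pmf_kernel: "pmf (kernel x) y = trans_prob \<rho> \<nu> \<phi> x y"
proof -
  have "pmf (kernel x) y = step_mean (indicator {y}) x" by (simp add: pmf.rep_eq)
  also have "\<dots> = (\<Sum>i\<in>UNIV. pmf \<nu> i * miss x i * indicator {y} (x(i := x i + 1))) +
      (\<Sum>i\<in>UNIV. pmf \<nu> i * (1 - miss x i) * indicator {y} (x(\<phi> x i := x (\<phi> x i) - 1)))"
    unfolding step_mean_kernel sum.distrib[symmetric] by (intro sum.cong) (auto simp: algebra_simps)
  also have "(\<Sum>i\<in>UNIV. pmf \<nu> i * (1 - miss x i) * indicator {y} (x(\<phi> x i := x (\<phi> x i) - 1))) =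
      (\<Sum>j\<in>UNIV. \<Sum>i | \<phi> x i = j. pmf \<nu> i * (1 - miss x i) * indicator {y} (x(\<phi> x i := x (\<phi> x i) - 1)))"
    using sum.group[of UNIV UNIV "\<phi> x"
        "\<lambda>i. pmf \<nu> i * (1 - miss x i) * indicator {y} (x(\<phi> x i := x (\<phi> x i) - 1))"] by simp
  also have "\<dots> = (\<Sum>j\<in>UNIV. if 0 < x j \<and> y = x(j := x j - 1)
      then (\<Sum>i | \<phi> x i = j. pmf \<nu> i * (1 - (1 - \<rho> i j) ^ x j)) else 0)"
  proof (rule sum.cong[OF refl])
    fix j
    show "(\<Sum>i | \<phi> x i = j. pmf \<nu> i * (1 - miss x i) * indicator {y} (x(\<phi> x i := x (\<phi> x i) - 1))) =
        (if 0 < x j \<and> y = x(j := x j - 1)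
         then (\<Sum>i | \<phi> x i = j. pmf \<nu> i * (1 - (1 - \<rho> i j) ^ x j)) else 0)"
      by (auto simp: miss_def indicator_def intro!: sum.cong sum.neutral)
  qed
  also have "(\<Sum>i\<in>UNIV. pmf \<nu> i * miss x i * indicator {y} (x(i := x i + 1))) =
      (\<Sum>i\<in>UNIV. if y = x(i := x i + 1) then pmf \<nu> i * (1 - \<rho> i (\<phi> x i)) ^ x (\<phi> x i) else 0)"
    by (intro sum.cong) (auto simp: miss_def indicator_def)
  finally show ?thesis unfolding trans_prob_def .
qed

lemma kernel_support:
  assumes "y \<in> set_pmf (kernel x)"
  shows "\<exists>i. y = x(i := x i + 1) \<or> 0 < x i \<and> y = x(i := x i - 1)"
proof -
  have "trans_prob \<rho> \<nu> \<phi> x y = 0"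
    if "\<And>i. y \<noteq> x(i := x i + 1)" "\<And>i. \<not> (0 < x i \<and> y = x(i := x i - 1))"
    unfolding trans_prob_def using that by (simp only: if_False sum.neutral_const simp_thms)
  moreover from assms have "trans_prob \<rho> \<nu> \<phi> x y \<noteq> 0"
    by (simp add: pmf_kernel[symmetric] set_pmf_iff)
  ultimately show ?thesis by blast
qed

lemma finite_predecessors: "finite {x. y \<in> set_pmf (kernel x)}"
proof (rule finite_subset)
  show "{x. y \<in> set_pmf (kernel x)} \<subseteq> (\<Union>i. {y(i := y i - 1), y(i := y i + 1)})"
  proof
    fix x assume "x \<in> {x. y \<in> set_pmf (kernel x)}"
    then obtain i where "y = x(i := x i + 1) \<or> 0 < x i \<and> y = x(i := x i - 1)"
      using kernel_support by blast
    then have "x = y(i := y i - 1) \<or> x = y(i := y i + 1)" by (auto simp: fun_eq_iff)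
    then show "x \<in> (\<Union>i. {y(i := y i - 1), y(i := y i + 1)})" by blast
  qed
qed simp

lemma weight_pos: "0 < w k (\<rho> i j) \<longleftrightarrow> 0 < k \<and> 0 < \<rho> i j"
  using weight \<rho>_unit[of i j] unfolding weight_function_def by blast

lemma weight_mono: "k \<le> k' \<Longrightarrow> w k (\<rho> i j) \<le> w k' 1"
proof -
  assume "k \<le> k'"
  then have "w k (\<rho> i j) \<le> w k' (\<rho> i j)"
    using weight \<rho>_unit[of i j] unfolding weight_function_def by blast
  also have "\<dots> \<le> w k' 1"
    using weight \<rho>_unit[of i j] unfolding weight_function_def by (metis atLeastAtMost_iff order_refl zero_le_one)
  finally show ?thesis .
qed

lemma exists_neighbour: "\<exists>j. 0 < \<rho> i j"
proof (rule ccontr)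
  assume none: "\<nexists>j. 0 < \<rho> i j"
  then have "root_independent \<rho> {i}" "root_neighbours \<rho> {i} = {}"
    by (auto simp: root_independent_def root_neighbours_def root_edge_def)
  with ncond show False unfolding NCOND_def
    by (metis insert_not_empty measure_empty measure_nonneg not_less)
qed

lemma policy_compatible:
  assumes "0 < \<rho> i j" "0 < x j"
  shows "0 < \<rho> i (\<phi> x i)" "0 < x (\<phi> x i)"
proof -
  have "0 < w (x j) (\<rho> i j)" using assms by (simp add: weight_pos)
  also have "\<dots> \<le> w (x (\<phi> x i)) (\<rho> i (\<phi> x i))" by (rule policy_maximal[OF \<alpha>_inj])
  finally show "0 < \<rho> i (\<phi> x i)" "0 < x (\<phi> x i)" by (auto simp: weight_pos)
qed

text \<open>
  NCOND gives every nonempty queue a class that is compatible with it. An arrival of such a class finds a match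
  with positive probability, which removes one item.
\<close>

lemma reaches_empty: "(x, \<lambda>_. 0) \<in> {(x, y). y \<in> set_pmf (kernel x)}\<^sup>*"
proof (induction "\<Sum>i\<in>UNIV. x i" arbitrary: x rule: less_induct)
  case less
  show ?case
  proof (cases "x = (\<lambda>_. 0)")
    case False
    then obtain j where j: "0 < x j" by (auto simp: fun_eq_iff)
    obtain i where i: "0 < \<rho> i j" using exists_neighbour[of j] \<rho>_sym by metis
    let ?k = "\<phi> x i"
    let ?y = "x(?k := x ?k - 1)"
    from policy_compatible[of i j x, OF i j] have k: "0 < \<rho> i ?k" "0 < x ?k" .
    have "miss x i < 1"
    proof (cases "x ?k")
      case (Suc l)
      have "(1 - \<rho> i ?k) ^ Suc l \<le> 1 - \<rho> i ?k"
        using \<rho>_unit[of i ?k] power_decreasing[of 1 "Suc l" "1 - \<rho> i ?k"] by simp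
      then have "(1 - \<rho> i ?k) ^ Suc l < 1" using k(1) by linarith
      then show ?thesis by (simp only: miss_def Suc)
    qed (use k(2) in simp)
    then have "False \<in> set_pmf (bernoulli_pmf (miss x i))"
      by (simp add: set_pmf_iff miss_unit)
    moreover have "i \<in> set_pmf \<nu>" using \<nu>_pos[of i] by (simp add: set_pmf_iff)
    ultimately have step: "?y \<in> set_pmf (kernel x)" unfolding kernel_def by force
    have dec: "(\<Sum>i\<in>UNIV. ?y i) < (\<Sum>i\<in>UNIV. x i)"
      using k(2) by (intro sum_strict_mono_ex1) auto
    from step have "(x, ?y) \<in> {(x, y). y \<in> set_pmf (kernel x)}" by simp
    from converse_rtrancl_into_rtrancl[OF this less[OF dec]] show ?thesis .
  qed simp
qed

definition longest_compatible :: "('c \<Rightarrow> nat) \<Rightarrow> 'c \<Rightarrow> nat" where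
  "longest_compatible x i = Max (insert 0 (x ` {j. 0 < \<rho> i j}))"

lemma longest_compatible_ge: "0 < \<rho> i j \<Longrightarrow> x j \<le> longest_compatible x i"
  unfolding longest_compatible_def by (rule Max_ge) auto

lemma longest_compatible_attained: "0 < longest_compatible x i \<Longrightarrow> \<exists>j. 0 < \<rho> i j \<and> x j = longest_compatible x i"
proof -
  assume pos: "0 < longest_compatible x i"
  have "longest_compatible x i \<in> insert 0 (x ` {j. 0 < \<rho> i j})" unfolding longest_compatible_def by (rule Max_in) auto
  with pos show ?thesis by auto
qed

text \<open>
  For long queues a single additional item outweighs any difference between positive compatibilities, so the
  policy picks the longest of the compatible queues.
\<close>

lemma policy_selects_longest:
  "\<exists>m\<ge>1. \<forall>x i. m \<le> longest_compatible x i \<longrightarrow> 0 < \<rho> i (\<phi> x i) \<and> x (\<phi> x i) = longest_compatible x i"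
proof -
  define Q where "Q i j m \<longleftrightarrow> (0 < \<rho> i j \<longrightarrow> (\<forall>k\<ge>m. w (k - 1) 1 < w k (\<rho> i j)))" for i j and m :: nat
  have "\<exists>m. Q i j m" for i j
  proof (cases "0 < \<rho> i j")
    case True
    then have "\<rho> i j \<in> {0<..1}" using \<rho>_unit[of i j] by auto
    moreover have "\<forall>r\<in>{0<..1}. \<exists>m\<ge>1. \<forall>k\<ge>m. w (k - 1) 1 < w k r \<and> w k 1 < w (k + 1) r"
      using weight unfolding weight_function_def by (elim conjE)
    ultimately show ?thesis unfolding Q_def by blast
  qed (simp add: Q_def)
  then obtain f where "\<And>i j. Q i j (f i j)" by metis
  then have f: "w (k - 1) 1 < w k (\<rho> i j)" if "0 < \<rho> i j" "f i j \<le> k" for i j k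
    using that unfolding Q_def by blast
  define m where "m = Max (insert 1 (range (\<lambda>(i, j). f i j)))"
  have m1: "1 \<le> m" unfolding m_def by (rule Max_ge) auto
  have fm: "f i j \<le> m" for i j
    unfolding m_def by (rule Max_ge) (auto intro!: rev_image_eqI[of "(i, j)"])
  have "0 < \<rho> i (\<phi> x i) \<and> x (\<phi> x i) = longest_compatible x i" if m: "m \<le> longest_compatible x i" for x i
  proof -
    obtain j where j: "0 < \<rho> i j" "x j = longest_compatible x i"
      using longest_compatible_attained[of x i] m m1 by auto
    have pos: "0 < \<rho> i (\<phi> x i)" by (rule policy_compatible(1)[OF j(1)]) (use j m m1 in simp)
    have "longest_compatible x i \<le> x (\<phi> x i)"
    proof (rule ccontr)
      assume "\<not> longest_compatible x i \<le> x (\<phi> x i)"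
      then have "w (x (\<phi> x i)) (\<rho> i (\<phi> x i)) \<le> w (longest_compatible x i - 1) 1"
        by (intro weight_mono) simp
      also have "\<dots> < w (x j) (\<rho> i j)"
        unfolding j(2) by (rule f[OF j(1)]) (rule order_trans[OF fm m])
      also have "\<dots> \<le> w (x (\<phi> x i)) (\<rho> i (\<phi> x i))" by (rule policy_maximal[OF \<alpha>_inj])
      finally show False by simp
    qed
    with longest_compatible_ge[OF pos, of x] pos show ?thesis by simp
  qed
  with m1 show ?thesis by blast
qed

text \<open>
  At each level \<open>s\<close>, the classes of \<open>J\<close> with more than \<open>s\<close> items form an independent set, and each of its
  neighbours has a compatible queue of more than \<open>s\<close> items. NCOND applies to each level, and summing over the
  levels gives the claim.
\<close>

lemma independent_mass_le:
  assumes \<delta>: "\<And>I. root_independent \<rho> I \<Longrightarrow>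
      measure_pmf.prob \<nu> I \<le> (1 - \<delta>) * measure_pmf.prob \<nu> (root_neighbours \<rho> I)" and \<delta>1: "\<delta> \<le> 1"
    and J: "root_independent \<rho> J"
  shows "(\<Sum>i\<in>J. pmf \<nu> i * real (x i)) \<le> (1 - \<delta>) * (\<Sum>i\<in>UNIV. pmf \<nu> i * real (longest_compatible x i))"
proof -
  define B where "B = Max (range x)"
  have B: "x i \<le> B" for i unfolding B_def by (rule Max_ge) auto
  have LB: "longest_compatible x i \<le> B" for i unfolding longest_compatible_def using B by auto
  have "(\<Sum>i\<in>J. pmf \<nu> i * real (x i)) = (\<Sum>s<B. \<Sum>i | i \<in> J \<and> s < x i. pmf \<nu> i)"
    by (rule layer_cake) (auto simp: B)
  also have "\<dots> \<le> (\<Sum>s<B. (1 - \<delta>) * (\<Sum>i | i \<in> UNIV \<and> s < longest_compatible x i. pmf \<nu> i))"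
  proof (rule sum_mono)
    fix s
    let ?I = "{i. i \<in> J \<and> s < x i}"
    have "root_independent \<rho> ?I" using J unfolding root_independent_def by blast
    from \<delta>[OF this] have "(\<Sum>i\<in>?I. pmf \<nu> i) \<le> (1 - \<delta>) * measure_pmf.prob \<nu> (root_neighbours \<rho> ?I)"
      by (simp add: measure_measure_pmf_finite)
    also have "\<dots> \<le> (1 - \<delta>) * measure_pmf.prob \<nu> {i. s < longest_compatible x i}"
    proof (intro mult_left_mono measure_pmf.finite_measure_mono)
      show "root_neighbours \<rho> ?I \<subseteq> {i. s < longest_compatible x i}"
        using longest_compatible_ge \<rho>_sym by (fastforce simp: root_neighbours_def root_edge_def intro: less_le_trans)
    qed (use \<delta>1 in auto)
    finally show "(\<Sum>i\<in>?I. pmf \<nu> i) \<le> (1 - \<delta>) * (\<Sum>i | i \<in> UNIV \<and> s < longest_compatible x i. pmf \<nu> i)"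
      by (simp add: measure_measure_pmf_finite)
  qed
  also have "\<dots> = (1 - \<delta>) * (\<Sum>i\<in>UNIV. pmf \<nu> i * real (longest_compatible x i))"
    by (subst layer_cake[of UNIV "longest_compatible x" B]) (auto simp: LB sum_distrib_left)
  finally show ?thesis .
qed

text \<open>
  The longest of all queues is compatible with some class, which has at least the smallest of the weights
  \<open>pmf \<nu> i\<close>.
\<close>

lemma mean_longest_dominates_sup_norm:
  "\<exists>\<kappa>. 0 < \<kappa> \<and> \<kappa> \<le> 1 \<and> (\<forall>x. \<kappa> * sup_norm x \<le> (\<Sum>i\<in>UNIV. pmf \<nu> i * real (longest_compatible x i)))"
proof -
  define \<kappa> where "\<kappa> = Min (range (pmf \<nu>))"
  have "\<kappa> \<in> range (pmf \<nu>)" unfolding \<kappa>_def by (rule Min_in) auto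
  then have "0 < \<kappa>" "\<kappa> \<le> 1" using \<nu>_pos pmf_le_1 by auto
  moreover have "\<kappa> * sup_norm x \<le> (\<Sum>i\<in>UNIV. pmf \<nu> i * real (longest_compatible x i))" for x
  proof -
    obtain j where j: "sup_norm x = real (x j)" using sup_norm_attained by blast
    obtain i where i: "0 < \<rho> i j" using exists_neighbour[of j] \<rho>_sym by metis
    have "\<kappa> \<le> pmf \<nu> i" unfolding \<kappa>_def by (rule Min_le) auto
    then have "\<kappa> * sup_norm x \<le> pmf \<nu> i * real (longest_compatible x i)"
      using longest_compatible_ge[OF i, of x] j \<open>0 < \<kappa>\<close> by (intro mult_mono) (auto simp: pmf_nonneg)
    also have "\<dots> \<le> (\<Sum>i\<in>UNIV. pmf \<nu> i * real (longest_compatible x i))"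
      by (rule member_le_sum) (auto simp: pmf_nonneg)
    finally show ?thesis .
  qed
  ultimately show ?thesis by blast
qed

definition energy :: "('c \<Rightarrow> nat) \<Rightarrow> real" where
  "energy x = (\<Sum>i\<in>UNIV. (real (x i))\<^sup>2)"

lemma energy_update: "energy (x(i := v)) = energy x - (real (x i))\<^sup>2 + (real v)\<^sup>2"
proof -
  have "energy (x(i := v)) = (real v)\<^sup>2 + (\<Sum>j\<in>UNIV - {i}. (real (x j))\<^sup>2)"
    unfolding energy_def by (subst sum.remove[of UNIV i]) (auto intro!: sum.cong)
  moreover have "energy x = (real (x i))\<^sup>2 + (\<Sum>j\<in>UNIV - {i}. (real (x j))\<^sup>2)"
    unfolding energy_def by (rule sum.remove) auto
  ultimately show ?thesis by simp
qed

text \<open>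
  A square changes by \<open>2 * x i + 1\<close> when the queue grows and by \<open>- 2 * x j + 1\<close> when it shrinks.
\<close>

lemma step_mean_energy:
  "step_mean energy x = energy x + 1 + 2 * (\<Sum>i\<in>UNIV. pmf \<nu> i * (miss x i * real (x i) - (1 - miss x i) * real (x (\<phi> x i))))"
proof -
  have "step_mean energy x = (\<Sum>i\<in>UNIV. pmf \<nu> i * (energy x + 1) +
      2 * (pmf \<nu> i * (miss x i * real (x i) - (1 - miss x i) * real (x (\<phi> x i)))))"
    unfolding step_mean_kernel
  proof (rule sum.cong[OF refl])
    fix i
    let ?j = "\<phi> x i"
    have "energy (x(i := x i + 1)) = energy x + 2 * real (x i) + 1"
      unfolding energy_update by (simp add: power2_eq_square algebra_simps)
    moreover have "(1 - miss x i) * energy (x(?j := x ?j - 1)) =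
        (1 - miss x i) * (energy x - 2 * real (x ?j) + 1)"
    proof (cases "x ?j")
      case 0
      then have "miss x i = 1" by (simp add: miss_def)
      then show ?thesis by simp
    next
      case (Suc k)
      then have "energy (x(?j := x ?j - 1)) = energy x - 2 * real (x ?j) + 1"
        unfolding energy_update by (simp add: power2_eq_square algebra_simps)
      then show ?thesis by simp
    qed
    ultimately have "miss x i * energy (x(i := x i + 1)) + (1 - miss x i) * energy (x(?j := x ?j - 1)) =
       energy x + 1 + 2 * (miss x i * real (x i) - (1 - miss x i) * real (x ?j))"
      by (simp add: algebra_simps)
    then show "pmf \<nu> i * (miss x i * energy (x(i := x i + 1)) + (1 - miss x i) * energy (x(?j := x ?j - 1))) =
      pmf \<nu> i * (energy x + 1) + 2 * (pmf \<nu> i * (miss x i * real (x i) - (1 - miss x i) * real (x ?j)))"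
      by (simp only: distrib_left mult.left_commute)
  qed
  also have "\<dots> = (\<Sum>i\<in>UNIV. pmf \<nu> i) * (energy x + 1) +
      2 * (\<Sum>i\<in>UNIV. pmf \<nu> i * (miss x i * real (x i) - (1 - miss x i) * real (x (\<phi> x i))))"
    by (simp only: sum.distrib sum_distrib_left sum_distrib_right)
  also have "(\<Sum>i\<in>UNIV. pmf \<nu> i) = 1" by (rule sum_pmf_eq_1) auto
  finally show ?thesis by simp
qed

text \<open>
  Fix a large threshold \<open>k\<close>. If the longest queue compatible with class \<open>i\<close> has at least \<open>k\<close> items then an
  arrival of class \<open>i\<close> is matched there with probability at least \<open>1 - \<epsilon>\<close>. The other classes contribute at most
  their own queue length, and those with at least \<open>k\<close> items form an independent set, since two compatible queues
  of that length would see each other. Thus \<open>independent_mass_le\<close> bounds their contribution by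
  \<open>1 - \<delta>\<close> times the term that the matches remove.
\<close>

lemma energy_drift:
  "\<exists>C\<ge>0. \<exists>c>0. \<forall>x. step_mean energy x \<le> energy x + C - c * sup_norm x"
proof -
  obtain \<delta> where \<delta>: "0 < \<delta>" "\<delta> \<le> 1" "\<And>I. root_independent \<rho> I \<Longrightarrow>
      measure_pmf.prob \<nu> I \<le> (1 - \<delta>) * measure_pmf.prob \<nu> (root_neighbours \<rho> I)"
    using NCOND_uniform[OF ncond] by blast
  obtain \<kappa> where \<kappa>: "0 < \<kappa>" "\<kappa> \<le> 1"
      "\<And>x. \<kappa> * sup_norm x \<le> (\<Sum>i\<in>UNIV. pmf \<nu> i * real (longest_compatible x i))"
    using mean_longest_dominates_sup_norm by blast
  obtain m where m: "1 \<le> m"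
      "\<And>x i. m \<le> longest_compatible x i \<Longrightarrow> 0 < \<rho> i (\<phi> x i) \<and> x (\<phi> x i) = longest_compatible x i"
    using policy_selects_longest by blast
  obtain r where r: "0 < r" "r \<le> 1" "\<And>i j. 0 < \<rho> i j \<Longrightarrow> r \<le> \<rho> i j"
    using ex_lower_bound_positive[of \<rho>] by blast
  \<comment> \<open>small enough that \<open>\<epsilon> - (\<delta> - \<epsilon>) * \<kappa> \<le> - \<delta> * \<kappa> / 2\<close>, where \<open>\<kappa> \<le> 1\<close>\<close>
  define \<epsilon> where "\<epsilon> = \<delta> * \<kappa> / 4"
  have \<epsilon>: "0 < \<epsilon>" "\<epsilon> \<le> 1" "\<epsilon> \<le> \<delta>"
  proof -
    have "\<delta> * \<kappa> \<le> \<delta> * 1" using \<delta> \<kappa> by (intro mult_left_mono) auto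
    moreover have "0 < \<delta> * \<kappa>" using \<delta> \<kappa> by simp
    ultimately show "0 < \<epsilon>" "\<epsilon> \<le> 1" "\<epsilon> \<le> \<delta>"
      using \<delta>(1,2) unfolding \<epsilon>_def by linarith+
  qed
  obtain l where l: "(1 - r) ^ l < \<epsilon>"
    using real_arch_pow_inv[of \<epsilon> "1 - r"] \<epsilon> r by auto
  define k where "k = max m l"
  have km: "m \<le> k" and kl: "l \<le> k" by (auto simp: k_def)
  have pow: "(1 - r) ^ n \<le> \<epsilon>" if "k \<le> n" for n
  proof -
    have "(1 - r) ^ n \<le> (1 - r) ^ l" using r that kl by (intro power_decreasing) auto
    with l show ?thesis by linarith
  qed
  have class_le: "miss x i * real (x i) - (1 - miss x i) * real (x (\<phi> x i)) \<le>
      (if longest_compatible x i < k \<and> k \<le> x i then real (x i) else 0) + \<epsilon> * sup_norm x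
        - (1 - \<epsilon>) * real (longest_compatible x i) + 2 * real k" for x i
  proof (cases "longest_compatible x i < k")
    case True
    have "miss x i * real (x i) \<le> real (x i)" "0 \<le> (1 - miss x i) * real (x (\<phi> x i))"
      using miss_unit[of x i] by (auto intro: mult_left_le_one_le)
    moreover have "(1 - \<epsilon>) * real (longest_compatible x i) \<le> 1 * real k"
      using True \<epsilon> by (intro mult_mono) auto
    moreover have "0 \<le> \<epsilon> * sup_norm x" using \<epsilon>(1) sup_norm_nonneg[of x] by simp
    moreover have "real (x i) \<le> (if longest_compatible x i < k \<and> k \<le> x i then real (x i) else 0) + real k"
      using True by auto
    ultimately show ?thesis by linarith
  next
    case False
    then have sel: "0 < \<rho> i (\<phi> x i)" "x (\<phi> x i) = longest_compatible x i" using m(2)[of x i] km by auto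
    have "miss x i \<le> (1 - r) ^ longest_compatible x i"
      unfolding miss_def sel(2) using r(3)[OF sel(1)] \<rho>_unit[of i "\<phi> x i"] by (intro power_mono) auto
    also have "\<dots> \<le> \<epsilon>" using False by (intro pow) simp
    finally have miss: "miss x i \<le> \<epsilon>" .
    have "miss x i * real (x i) \<le> \<epsilon> * sup_norm x"
      using miss \<epsilon> sup_norm_ge by (intro mult_mono) auto
    moreover have "(1 - \<epsilon>) * real (longest_compatible x i) \<le> (1 - miss x i) * real (x (\<phi> x i))"
      unfolding sel(2) using miss by (intro mult_right_mono) auto
    ultimately show ?thesis using False by simp
  qed
  have "step_mean energy x \<le> energy x + (1 + 4 * real k) - (\<delta> * \<kappa>) * sup_norm x" for x
  proof -
    let ?J = "{i. longest_compatible x i < k \<and> k \<le> x i}"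
    let ?L = "\<Sum>i\<in>UNIV. pmf \<nu> i * real (longest_compatible x i)"
    have one: "(\<Sum>i\<in>UNIV. pmf \<nu> i) = 1" by (rule sum_pmf_eq_1) auto
    have J: "root_independent \<rho> ?J"
      unfolding root_independent_def root_edge_def
    proof (intro ballI notI)
      fix i j assume ij: "i \<in> ?J" "j \<in> ?J" "0 < \<rho> i j"
      from longest_compatible_ge[OF ij(3), of x] ij show False by simp
    qed
    have "(\<Sum>i\<in>UNIV. pmf \<nu> i * (miss x i * real (x i) - (1 - miss x i) * real (x (\<phi> x i)))) \<le>
      (\<Sum>i\<in>UNIV. pmf \<nu> i * ((if i \<in> ?J then real (x i) else 0) + \<epsilon> * sup_norm x
        - (1 - \<epsilon>) * real (longest_compatible x i) + 2 * real k))"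
      using class_le[of x] by (intro sum_mono mult_left_mono) (auto simp: pmf_nonneg)
    also have "\<dots> = (\<Sum>i\<in>UNIV. (if i \<in> ?J then pmf \<nu> i * real (x i) else 0) + pmf \<nu> i * (\<epsilon> * sup_norm x + 2 * real k)
        - (1 - \<epsilon>) * (pmf \<nu> i * real (longest_compatible x i)))"
      by (intro sum.cong) (auto simp: algebra_simps)
    also have "\<dots> = (\<Sum>i\<in>UNIV. if i \<in> ?J then pmf \<nu> i * real (x i) else 0) + (\<Sum>i\<in>UNIV. pmf \<nu> i) * (\<epsilon> * sup_norm x + 2 * real k)
        - (1 - \<epsilon>) * ?L"
      by (simp only: sum.distrib sum_subtractf sum_distrib_left sum_distrib_right)
    also have "(\<Sum>i\<in>UNIV. if i \<in> ?J then pmf \<nu> i * real (x i) else 0) = (\<Sum>i\<in>?J. pmf \<nu> i * real (x i))"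
      by (subst sum.inter_restrict[symmetric]) auto
    also have "(\<Sum>i\<in>?J. pmf \<nu> i * real (x i)) \<le> (1 - \<delta>) * ?L"
      by (rule independent_mass_le[OF \<delta>(3) \<delta>(2) J])
    finally have "(\<Sum>i\<in>UNIV. pmf \<nu> i * (miss x i * real (x i) - (1 - miss x i) * real (x (\<phi> x i)))) \<le>
      \<epsilon> * sup_norm x + 2 * real k - (\<delta> - \<epsilon>) * ?L" by (simp add: one algebra_simps)
    moreover have "(\<delta> - \<epsilon>) * (\<kappa> * sup_norm x) \<le> (\<delta> - \<epsilon>) * ?L"
      using \<epsilon> by (intro mult_left_mono \<kappa>(3)) auto
    moreover have "\<epsilon> * sup_norm x - (\<delta> - \<epsilon>) * (\<kappa> * sup_norm x) \<le> - (\<delta> * \<kappa> / 2) * sup_norm x"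
    proof -
      have "\<epsilon> * \<kappa> \<le> \<epsilon>" using \<epsilon> \<kappa> by (intro mult_left_le) auto
      then have "\<epsilon> - (\<delta> - \<epsilon>) * \<kappa> \<le> - (\<delta> * \<kappa> / 2)" by (simp add: \<epsilon>_def algebra_simps)
      from mult_right_mono[OF this sup_norm_nonneg[of x]] show ?thesis
        by (simp add: left_diff_distrib mult.assoc)
    qed
    ultimately show ?thesis unfolding step_mean_energy by simp
  qed
  then show ?thesis using \<delta>(1) \<kappa>(1)
    by (intro exI[of _ "1 + 4 * real k"] conjI exI[of _ "\<delta> * \<kappa>"]) auto
qed

lemma lyapunov_energy: "lyapunov sup_norm 1 energy"
  unfolding lyapunov_def
proof (intro conjI)
  show "\<forall>x. 0 \<le> energy x" by (simp add: energy_def sum_nonneg)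
  show "\<exists>A\<ge>0. \<forall>x. energy x \<le> A * (1 + sup_norm x) ^ (1 + 1)"
  proof (intro exI conjI allI)
    fix x :: "'c \<Rightarrow> nat"
    have "energy x \<le> (\<Sum>i\<in>(UNIV :: 'c set). (1 + sup_norm x)\<^sup>2)"
      unfolding energy_def
    proof (intro sum_mono power_mono)
      show "real (x i) \<le> 1 + sup_norm x" for i using sup_norm_ge[of x i] by simp
    qed simp
    then show "energy x \<le> real CARD('c) * (1 + sup_norm x) ^ (1 + 1)" by (simp add: power2_eq_square)
  qed simp
  show "\<exists>b\<ge>0. \<forall>x. \<forall>y\<in>set_pmf (kernel x). \<bar>energy y - energy x\<bar> \<le> b * (1 + sup_norm x) ^ 1"
  proof (intro exI[of _ 2] conjI allI ballI)
    fix x y assume "y \<in> set_pmf (kernel x)"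
    then obtain i where i: "y = x(i := x i + 1) \<or> 0 < x i \<and> y = x(i := x i - 1)"
      using kernel_support by blast
    then have "\<bar>energy y - energy x\<bar> \<le> 2 * real (x i) + 1"
    proof
      assume "0 < x i \<and> y = x(i := x i - 1)"
      then show ?thesis by (cases "x i") (auto simp: energy_update power2_eq_square algebra_simps)
    qed (auto simp: energy_update power2_eq_square algebra_simps)
    then show "\<bar>energy y - energy x\<bar> \<le> 2 * (1 + sup_norm x) ^ 1"
      using sup_norm_ge[of x i] by simp
  qed simp
  show "\<forall>x. sup_norm x ^ (1 + 1) \<le> energy x"
  proof
    fix x :: "'c \<Rightarrow> nat"
    obtain i where i: "sup_norm x = real (x i)" using sup_norm_attained by blast
    have "(real (x i))\<^sup>2 \<le> energy x"
      unfolding energy_def by (rule member_le_sum[where f="\<lambda>i. (real (x i))\<^sup>2"]) auto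
    then show "sup_norm x ^ (1 + 1) \<le> energy x" by (simp add: i power2_eq_square)
  qed
  show "\<exists>C\<ge>0. \<exists>c>0. \<forall>x. step_mean energy x \<le> energy x + C - c * sup_norm x ^ 1"
    using energy_drift by simp
qed

end

section \<open>Long-run average of the largest queue\<close>

theorem corollary3p4:
  fixes \<nu> :: "'c::finite pmf"
    and \<rho> :: "'c \<Rightarrow> 'c \<Rightarrow> real"
    and w :: "nat \<Rightarrow> real \<Rightarrow> real"
    and \<alpha> :: "'c \<Rightarrow> nat"
    and M :: "'a measure"
    and X :: "nat \<Rightarrow> 'a \<Rightarrow> 'c \<Rightarrow> nat"
  defines "P \<equiv> trans_prob \<rho> \<nu> (policy \<rho> w \<alpha>)"
  assumes "\<And>i. pmf \<nu> i > 0"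
    and "\<And>i j. \<rho> i j \<in> {0..1}"
    and "\<And>i j. \<rho> i j = \<rho> j i"
    and "weight_function w"
    and "bij_betw \<alpha> UNIV {1..CARD('c)}"
    and "markov_chain M X P (\<lambda>_. 0)"
    and "NCOND \<rho> \<nu>"
  shows "\<exists>\<pi>. invariant_distribution (state_space M X) P \<pi> \<and>
           (\<forall>\<pi>'. invariant_distribution (state_space M X) P \<pi>' \<longrightarrow> \<pi>' = \<pi>) \<and>
           integrable (measure_pmf \<pi>) sup_norm \<and>
           (AE \<omega> in M. (\<lambda>t. (1 / real t) * (\<Sum>s = 1..t. sup_norm (X s \<omega>)))
              \<longlonglongrightarrow> (\<integral>x. sup_norm x \<partial>measure_pmf \<pi>)) \<and>
           (AE \<omega> in M. (\<lambda>t. sup_norm (X t \<omega>) / real t) \<longlonglongrightarrow> 0)"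
proof -
  interpret matching \<nu> \<rho> w \<alpha>
    using assms(2-6,8) by unfold_locales (auto simp: bij_betw_def)
  have P: "P = (\<lambda>x y. pmf (kernel x) y)"
    unfolding P_def by (simp add: pmf_kernel fun_eq_iff)
  interpret finite_step_chain kernel M X "\<lambda>_. 0"
    using assms(7) by unfold_locales (simp add: P)
  obtain \<pi> where \<pi>: "invariant_distribution (state_space M X) P \<pi>"
      "\<forall>\<pi>'. invariant_distribution (state_space M X) P \<pi>' \<longrightarrow> \<pi>' = \<pi>"
      "integrable (measure_pmf \<pi>) sup_norm"
    and lim: "AE \<omega> in M. (\<lambda>t. (1 / real t) * (\<Sum>s = 1..t. sup_norm (X s \<omega>)))
      \<longlonglongrightarrow> (\<integral>x. sup_norm x \<partial>measure_pmf \<pi>)"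
    using ergodic_averages[OF finite_predecessors sup_norm_nonneg finite_sup_norm_le
        lyapunov_energy reaches_empty]
    unfolding P by blast
  moreover from lim have "AE \<omega> in M. (\<lambda>t. sup_norm (X t \<omega>) / real t) \<longlonglongrightarrow> 0"
    by eventually_elim (rule last_term_negligible)
  ultimately show ?thesis by blast
qed

end
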